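(* Let $z=(y,u)$, where $y$ ranges over a finite-dimensional smooth manifold and $u\in\mathcal U$ with $\mathcal U\subset\mathbb R^p$ open, let $\mathcal S$ be a finite-dimensional smooth manifold with points $\sigma$, and suppose $$E(y,\sigma,u)=E_0(y,\sigma)+\sum_{i=1}^p u_i\Delta_i(y,\sigma).$$ Assume that for some $r\ge2$: $E$ is $C^{r+1}$; for every compact set $K$ of parameters $z=(y,u)$ and every $c\in\mathbb R$ the set $\{\sigma:\exists (y,u)\in K,\ E(y,\sigma,u)\le c\}$ is relatively compact in $\mathcal S$; for every $z=(y,u)$ there is a unique interior minimizer $\sigma_\star(z)$ of $\sigma\mapsto E(y,\sigma,u)$; and $H(z):=E_{\sigma\sigma}$ at $(z,\sigma_\star(z))$ is positive definite. Let $\bar E(y,u)=E(y,\sigma_\star(y,u),u)$, and define at the canonical lift $\sigma=\sigma_\star(y,u)$ the map $$G:T_u\mathcal U\to T^*_\sigma\mathcal S,\qquad Ga=\sum_{i=1}^p a_iD_\sigma\Delta_i .$$ Then $$D^2_{uu}\bar E=-G^*H^{-1}G\preceq0,$$ equivalently $$\partial^2_{u_iu_j}\bar E=-\bigl\langle D_\sigma\Delta_i,\,H^{-1}D_\sigma\Delta_j\bigr\rangle\qquad(1\le i,j\le p).$$ Thus the self-curvature $\partial^2_{u_iu_i}\bar E$ of every mechanism is nonpositive; a pointwise mixed entry $\partial^2_{u_iu_j}\bar E$ vanishes exactly when $D_\sigma\Delta_i$ and $D_\sigma\Delta_j$ are orthogonal in the inner product on $T_\sigma^*\mathcal S$ induced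 by $H^{-1}$; and mixed entries may have either sign (positive and negative values both occur among instances satisfying these hypotheses).
   Context: Derivatives in $\sigma$ are taken in local coordinates on $\mathcal S$; at the fiber critical point $\sigma_\star$ the Hessian $H$ is an intrinsic positive definite form $T_\sigma\mathcal S\to T_\sigma^*\mathcal S$, $H^{-1}:T^*_\sigma\mathcal S\to T_\sigma\mathcal S$, and $\langle\cdot,\cdot\rangle$ is the pairing of covectors with vectors. All expressions are evaluated at $\sigma=\sigma_\star(y,u)$. *)

theory Defs
  imports "HOL-Analysis.Analysis"
begin

section \<open>Differential calculus\<close>

text \<open>\<open>Ck_on k f S\<close>: \<open>f\<close> is of class \<open>C\<^sup>k\<close> on the open set \<open>S\<close>. The recursion runs over
  directional derivatives because the type of the iterated total derivative changes with \<open>k\<close>; on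
  a finite-dimensional domain, the only case used below, this is the usual notion.\<close>

primrec Ck_on :: "nat \<Rightarrow> ('a::real_normed_vector \<Rightarrow> 'b::real_normed_vector) \<Rightarrow> 'a set \<Rightarrow> bool" where
  "Ck_on 0 f S \<longleftrightarrow> continuous_on S f"
| "Ck_on (Suc k) f S \<longleftrightarrow>
     (\<forall>x\<in>S. f differentiable (at x)) \<and> (\<forall>v. Ck_on k (\<lambda>x. frechet_derivative f (at x) v) S)"

definition fderiv ::
  "('a::real_normed_vector \<Rightarrow> 'b::real_normed_vector) \<Rightarrow> 'a \<Rightarrow> 'a \<Rightarrow>\<^sub>L 'b" where
  "fderiv f x = Blinfun (frechet_derivative f (at x))"

definition fderiv2 ::
  "('a::real_normed_vector \<Rightarrow> 'b::real_normed_vector) \<Rightarrow> 'a \<Rightarrow> 'a \<Rightarrow>\<^sub>L ('a \<Rightarrow>\<^sub>L 'b)" where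
  "fderiv2 f x = fderiv (fderiv f) x"

definition partial :: "'p::finite \<Rightarrow> (real^'p \<Rightarrow> real) \<Rightarrow> real^'p \<Rightarrow> real" where
  "partial i f u = deriv (\<lambda>t. f (u + t *\<^sub>R axis i 1)) 0"


section \<open>Smooth manifolds\<close>

text \<open>A chart is a domain together with a coordinate map, and a manifold is given by an atlas whose
  domains cover it. The model space is a real inner product space of finite dimension; the class
  \<^class>\<open>euclidean_space\<close> would exclude dimension zero.\<close>

type_synonym ('a, 'e) chart = "'a set \<times> ('a \<Rightarrow> 'e)"
type_synonym ('a, 'e) atlas = "('a, 'e) chart set"

definition is_chart :: "('a::topological_space, 'e::topological_space) chart \<Rightarrow> bool" where
  "is_chart c \<longleftrightarrow> open (fst c) \<and> open (snd c ` fst c) \<and>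
     (\<exists>g. homeomorphism (fst c) (snd c ` fst c) (snd c) g)"

definition chart_inv :: "('a, 'e) chart \<Rightarrow> 'e \<Rightarrow> 'a" where
  "chart_inv c = inv_into (fst c) (snd c)"

definition points :: "('a, 'e) atlas \<Rightarrow> 'a set" where
  "points A = (\<Union>c\<in>A. fst c)"

definition smooth_atlas ::
  "('a::{t2_space,second_countable_topology}, 'e::real_inner) atlas \<Rightarrow> bool" where
  "smooth_atlas A \<longleftrightarrow>
     (\<exists>B::'e set. finite B \<and> span B = UNIV) \<and>
     (\<forall>c\<in>A. is_chart c) \<and>
     (\<forall>c\<in>A. \<forall>d\<in>A. \<forall>k. Ck_on k (snd d \<circ> chart_inv c) (snd c ` (fst c \<inter> fst d)))"

definition relatively_compact_in :: "'a::topological_space set \<Rightarrow> 'a set \<Rightarrow> bool" where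
  "relatively_compact_in M A \<longleftrightarrow> A \<subseteq> M \<and> compact (M \<inter> closure A)"

text \<open>In the coordinates of a chart \<open>d\<close> around \<open>\<sigma>\<close>, tangent vectors at \<open>\<sigma>\<close> are elements of the
  model space \<open>'e\<close> and covectors are elements of \<open>'e \<Rightarrow>\<^sub>L real\<close>; the pairing of covectors with
  vectors is \<^const>\<open>blinfun_apply\<close>.\<close>

definition chart_differential ::
  "('s, 'e::real_normed_vector) chart \<Rightarrow> ('s \<Rightarrow> real) \<Rightarrow> 's \<Rightarrow> 'e \<Rightarrow>\<^sub>L real" where
  "chart_differential d f \<sigma> = fderiv (f \<circ> chart_inv d) (snd d \<sigma>)"

definition chart_hessian ::
  "('s, 'e::real_normed_vector) chart \<Rightarrow> ('s \<Rightarrow> real) \<Rightarrow> 's \<Rightarrow> 'e \<Rightarrow>\<^sub>L ('e \<Rightarrow>\<^sub>L real)" where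
  "chart_hessian d f \<sigma> = fderiv2 (f \<circ> chart_inv d) (snd d \<sigma>)"


section \<open>Forms and duals\<close>

definition positive_definite :: "('e::real_normed_vector \<Rightarrow>\<^sub>L ('e \<Rightarrow>\<^sub>L real)) \<Rightarrow> bool" where
  "positive_definite H \<longleftrightarrow> (\<forall>v. v \<noteq> 0 \<longrightarrow> blinfun_apply (blinfun_apply H v) v > 0)"

definition form_inv :: "('e::real_normed_vector \<Rightarrow>\<^sub>L ('e \<Rightarrow>\<^sub>L real)) \<Rightarrow> ('e \<Rightarrow>\<^sub>L real) \<Rightarrow> 'e" where
  "form_inv H = inv (blinfun_apply H)"

text \<open>The bilinear form \<open>(\<alpha>, \<beta>) \<mapsto> \<langle>\<alpha>, H\<^sup>-\<^sup>1 \<beta>\<rangle>\<close> on covectors.\<close>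

definition dual_form ::
  "('e::real_normed_vector \<Rightarrow>\<^sub>L ('e \<Rightarrow>\<^sub>L real)) \<Rightarrow> ('e \<Rightarrow>\<^sub>L real) \<Rightarrow> ('e \<Rightarrow>\<^sub>L real) \<Rightarrow> real" where
  "dual_form H \<alpha> \<beta> = blinfun_apply \<alpha> (form_inv H \<beta>)"

definition is_inner_product :: "('v::real_vector \<Rightarrow> 'v \<Rightarrow> real) \<Rightarrow> bool" where
  "is_inner_product B \<longleftrightarrow>
     (\<forall>x. linear (B x)) \<and> (\<forall>x y. B x y = B y x) \<and> (\<forall>x. x \<noteq> 0 \<longrightarrow> B x x > 0)"

text \<open>The dual \<open>V \<rightarrow> W\<^sup>*\<close> of a linear map \<open>W \<rightarrow> V\<^sup>*\<close>, with \<open>V\<close> identified with its bidual.\<close>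

definition dual_map ::
  "('w::real_normed_vector \<Rightarrow> ('v::real_normed_vector \<Rightarrow>\<^sub>L real)) \<Rightarrow> 'v \<Rightarrow> ('w \<Rightarrow>\<^sub>L real)" where
  "dual_map G v = Blinfun (\<lambda>a. blinfun_apply (G a) v)"


section \<open>Energies affine in the parameter\<close>

definition energy ::
  "('y \<Rightarrow> 's \<Rightarrow> real) \<Rightarrow> ('p::finite \<Rightarrow> 'y \<Rightarrow> 's \<Rightarrow> real) \<Rightarrow> 'y \<Rightarrow> 's \<Rightarrow> real^'p \<Rightarrow> real" where
  "energy E0 \<Delta> y \<sigma> u = E0 y \<sigma> + (\<Sum>i\<in>UNIV. u $ i * \<Delta> i y \<sigma>)"

text \<open>The chosen minimizer; \<open>energy_family\<close> below makes it the only one.\<close>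

definition minimizer ::
  "'s set \<Rightarrow> ('y \<Rightarrow> 's \<Rightarrow> real) \<Rightarrow> ('p::finite \<Rightarrow> 'y \<Rightarrow> 's \<Rightarrow> real) \<Rightarrow> 'y \<Rightarrow> real^'p \<Rightarrow> 's" where
  "minimizer S E0 \<Delta> y u = arg_min_on (\<lambda>\<sigma>. energy E0 \<Delta> y \<sigma> u) S"

definition reduced_energy ::
  "'s set \<Rightarrow> ('y \<Rightarrow> 's \<Rightarrow> real) \<Rightarrow> ('p::finite \<Rightarrow> 'y \<Rightarrow> 's \<Rightarrow> real) \<Rightarrow> 'y \<Rightarrow> real^'p \<Rightarrow> real" where
  "reduced_energy S E0 \<Delta> y u = energy E0 \<Delta> y (minimizer S E0 \<Delta> y u) u"

text \<open>The manifolds have no boundary, so every minimizer is interior. The Hessian at a critical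
  point is intrinsic, so positivity in one chart and in all charts is the same condition.\<close>

definition energy_family ::
  "nat \<Rightarrow> ('y::{t2_space,second_countable_topology}, 'ey::real_inner) atlas \<Rightarrow>
   ('s::{t2_space,second_countable_topology}, 'es::real_inner) atlas \<Rightarrow> (real^'p::finite) set \<Rightarrow>
   ('y \<Rightarrow> 's \<Rightarrow> real) \<Rightarrow> ('p \<Rightarrow> 'y \<Rightarrow> 's \<Rightarrow> real) \<Rightarrow> bool" where
  "energy_family r AY AS U E0 \<Delta> \<longleftrightarrow>
     r \<ge> 2 \<and> smooth_atlas AY \<and> smooth_atlas AS \<and> open U \<and>
     (\<forall>c\<in>AY. \<forall>d\<in>AS.
        Ck_on (r + 1) (\<lambda>(a, x, u). energy E0 \<Delta> (chart_inv c a) (chart_inv d x) u)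
          ((snd c ` fst c) \<times> (snd d ` fst d) \<times> U)) \<and>
     (\<forall>K e. compact K \<and> K \<subseteq> points AY \<times> U \<longrightarrow>
        relatively_compact_in (points AS)
          {\<sigma> \<in> points AS. \<exists>(y, u)\<in>K. energy E0 \<Delta> y \<sigma> u \<le> e}) \<and>
     (\<forall>y\<in>points AY. \<forall>u\<in>U.
        (\<exists>!\<sigma>. is_arg_min (\<lambda>\<sigma>. energy E0 \<Delta> y \<sigma> u) (\<lambda>\<sigma>. \<sigma> \<in> points AS) \<sigma>) \<and>
        (\<forall>d\<in>AS. minimizer (points AS) E0 \<Delta> y u \<in> fst d \<longrightarrow>
           positive_definite
             (chart_hessian d (\<lambda>\<sigma>. energy E0 \<Delta> y \<sigma> u) (minimizer (points AS) E0 \<Delta> y u))))"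

end

theory Submission
  imports Defs
begin

text \<open>
  Fix the base point \<open>y\<close> and write \<open>\<sigma> u\<close> for the minimizer. The energy is affine in \<open>u\<close>, so the
  minimizer at one parameter is a competitor at every other one. This squeezes the increment of the
  reduced energy between two linear expressions and shows that its gradient has the components
  \<open>\<Delta>\<^sub>i (\<sigma> u)\<close> as soon as \<open>\<sigma>\<close> is continuous (\<open>has_derivative_reduced_energy\<close>). Continuity of \<open>\<sigma>\<close> follows
  from the compactness of sublevel sets and the uniqueness of the minimizer (\<open>tendsto_minimizer\<close>).

  The second derivative is therefore the first derivative of \<open>u \<mapsto> \<Delta>\<^sub>i (\<sigma> u)\<close>. In a chart, \<open>\<sigma> u\<close>
  solves the equation \<open>D\<^sub>\<sigma> E = 0\<close>. Since a continuous solution is already known, a first-order expansion suffices: it gives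
  \<open>H (\<delta>\<sigma>) + G (\<delta>u) = o(\<bar>\<delta>\<sigma>\<bar> + \<bar>\<delta>u\<bar>)\<close>, and the invertibility of \<open>H\<close> turns this into the
  differentiability of \<open>\<sigma>\<close> with derivative \<open>- H\<^sup>-\<^sup>1 G\<close> (\<open>implicit_has_derivative\<close>,
  \<open>has_derivative_local_minimizer\<close>). The chain rule gives \<open>- \<langle>D\<Delta>\<^sub>i, H\<^sup>-\<^sup>1 D\<Delta>\<^sub>j\<rangle>\<close>. The reduced energy is of class
  \<open>C\<^sup>2\<close> because this expression is continuous in \<open>u\<close>, which rests on the continuity of inversion
  (\<open>tendsto_form_inv\<close>).

  The form \<open>\<langle>\<alpha>, H\<^sup>-\<^sup>1 \<beta>\<rangle>\<close> is an inner product since \<open>H\<close> is positive definite and, by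
  the symmetry of second derivatives (\<open>fderiv2_symmetric\<close>), symmetric; the signs of the self-curvatures
  and the orthogonality criterion follow. Two quadratic energies on the real line have mixed
  derivatives of opposite sign.
\<close>

section \<open>Finite-dimensional inner product spaces\<close>

text \<open>The model spaces have finite dimension without being of class \<^class>\<open>euclidean_space\<close>, so
  a finite family to expand vectors in has to be supplied. An orthonormal basis is one; the expansion is the
  form in which it enters the computations.\<close>

locale parseval_frame =
  fixes C :: "'e::real_inner set"
  assumes finite_frame: "finite C"
    and frame_expansion: "(\<Sum>c\<in>C. (v \<bullet> c) *\<^sub>R c) = v"

text \<open>Gram-Schmidt yields an orthogonal spanning set. After normalization, the error
  of the expansion is orthogonal to a spanning set, hence to itself.\<close>

lemma parseval_frame_exists:
  fixes B :: "'e::real_inner set"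
  assumes "finite B" "span B = UNIV"
  shows "\<exists>C::'e set. parseval_frame C"
proof -
  obtain A :: "'e set" where A: "finite A" "span A = span B" "pairwise orthogonal A"
    using basis_orthogonal[OF assms(1)] by blast
  define C where "C = (\<lambda>a. a /\<^sub>R norm a) ` (A - {0})"
  have finC: "finite C" using A(1) by (simp add: C_def)
  have ortho: "x \<bullet> y = (if x = y then 1 else 0)" if xy: "x \<in> C" "y \<in> C" for x y
  proof -
    obtain a b where ab: "a \<in> A" "b \<in> A" "a \<noteq> 0" "b \<noteq> 0" "x = a /\<^sub>R norm a" "y = b /\<^sub>R norm b"
      using xy unfolding C_def by auto
    show ?thesis
    proof (cases "a = b")
      case True
      have "x \<bullet> x = inverse (norm a) * (inverse (norm a) * (norm a * norm a))"
        using ab True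
        by (metis (no_types, lifting) inner_scaleR_left inner_scaleR_right dot_square_norm power2_eq_square)
      then show ?thesis using ab True by (simp add: field_simps)
    next
      case False
      then have "a \<bullet> b = 0" using A(3) ab by (simp add: pairwise_def orthogonal_def)
      then have "x \<bullet> y = 0" using ab by simp
      moreover have "x \<bullet> x \<noteq> 0" using ab by simp
      ultimately show ?thesis by auto
    qed
  qed
  have "A \<subseteq> span C"
  proof
    fix a assume "a \<in> A"
    show "a \<in> span C"
    proof (cases "a = 0")
      case False
      then have "a /\<^sub>R norm a \<in> C" using \<open>a \<in> A\<close> by (auto simp: C_def)
      then have "norm a *\<^sub>R (a /\<^sub>R norm a) \<in> span C" by (intro span_scale span_base)
      then show ?thesis using False by simp
    qed (simp add: span_zero)
  qed
  then have spanC: "span C = UNIV"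
    using A(2) assms(2) span_minimal[of A "span C"] by auto
  have "(\<Sum>c\<in>C. (v \<bullet> c) *\<^sub>R c) = v" for v
  proof -
    define w where "w = v - (\<Sum>c\<in>C. (v \<bullet> c) *\<^sub>R c)"
    have "w \<bullet> x = 0" if "x \<in> C" for x
    proof -
      have "(\<Sum>c\<in>C. (v \<bullet> c) *\<^sub>R c) \<bullet> x = (\<Sum>c\<in>C. if c = x then v \<bullet> x else 0)"
        unfolding inner_sum_left by (intro sum.cong) (auto simp: ortho that)
      also have "\<dots> = v \<bullet> x" using finC that by simp
      finally show ?thesis by (simp add: w_def inner_diff_left)
    qed
    moreover have "w \<in> span C" by (simp add: spanC)
    ultimately have "orthogonal w w"
      by (meson orthogonal_def orthogonal_to_span)
    then have "w = 0" by (simp add: orthogonal_self)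
    then show ?thesis by (simp add: w_def)
  qed
  with finC show ?thesis by (auto simp: parseval_frame_def)
qed

context parseval_frame
begin

lemma linear_expansion:
  assumes "linear (f :: 'e \<Rightarrow> 'b::real_vector)"
  shows "f v = (\<Sum>c\<in>C. (v \<bullet> c) *\<^sub>R f c)"
proof -
  have "f v = f (\<Sum>c\<in>C. (v \<bullet> c) *\<^sub>R c)" by (simp only: frame_expansion)
  also have "\<dots> = (\<Sum>c\<in>C. (v \<bullet> c) *\<^sub>R f c)" by (simp add: linear_sum[OF assms] linear_cmul[OF assms])
  finally show ?thesis .
qed

text \<open>Writing a bounded operator as a finite sum of operators of rank one turns differentiability and
  continuity of an operator-valued function into the same property of its values on the frame.\<close>

definition coords_blinfun :: "('e \<Rightarrow> 'b::real_normed_vector) \<Rightarrow> 'e \<Rightarrow>\<^sub>L 'b" where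
  "coords_blinfun f = (\<Sum>c\<in>C. blinfun_scaleR_left (f c) o\<^sub>L blinfun_inner_left c)"

lemma coords_blinfun_apply:
  assumes "linear f"
  shows "blinfun_apply (coords_blinfun f) v = f v"
  by (simp add: coords_blinfun_def blinfun.sum_left flip: linear_expansion[OF assms, of v])

lemma blinfun_expansion:
  fixes T :: "'e \<Rightarrow>\<^sub>L 'b::real_normed_vector"
  shows "coords_blinfun T = T"
  by (rule blinfun_eqI, rule coords_blinfun_apply, rule bounded_linear.linear,
      rule blinfun.bounded_linear_right)

text \<open>Positivity gives injectivity. For surjectivity, the Riesz map \<open>J\<close> identifies covectors with
  vectors, so that \<open>J \<circ> H\<close> is an injective endomorphism of a finite-dimensional space.\<close>

lemma pos_def_form_bij:
  fixes H :: "'e \<Rightarrow>\<^sub>L ('e \<Rightarrow>\<^sub>L real)"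
  assumes "positive_definite H"
  shows "bij (blinfun_apply H)"
proof -
  have linH: "linear (blinfun_apply H)"
    by (intro bounded_linear.linear blinfun.bounded_linear_right)
  have inj: "inj (blinfun_apply H)"
  proof (rule linear_injective_0[OF linH, THEN iffD2], intro allI impI, rule ccontr)
    fix v assume "blinfun_apply H v = 0" "v \<noteq> 0"
    then have "blinfun_apply (blinfun_apply H v) v = 0" by simp
    moreover have "blinfun_apply (blinfun_apply H v) v > 0"
      using assms \<open>v \<noteq> 0\<close> unfolding positive_definite_def by blast
    ultimately show False by simp
  qed
  define J :: "('e \<Rightarrow>\<^sub>L real) \<Rightarrow> 'e" where "J \<alpha> = (\<Sum>c\<in>C. \<alpha> c *\<^sub>R c)" for \<alpha>
  have J: "blinfun_apply \<alpha> v = J \<alpha> \<bullet> v" for \<alpha> v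
  proof -
    have "blinfun_apply \<alpha> v = (\<Sum>c\<in>C. (v \<bullet> c) * \<alpha> c)"
      using linear_expansion[OF bounded_linear.linear[OF blinfun.bounded_linear_right], of \<alpha> v]
      by simp
    then show ?thesis by (simp add: J_def inner_sum_left inner_commute[of v] mult.commute)
  qed
  have injJ: "\<alpha> = \<beta>" if "J \<alpha> = J \<beta>" for \<alpha> \<beta>
    by (rule blinfun_eqI) (simp add: J that)
  have linJ: "linear J"
    by (rule linearI)
       (simp_all add: J_def blinfun.add_left blinfun.scaleR_left scaleR_add_left sum.distrib scaleR_sum_right)
  obtain B where B: "B \<subseteq> C" "independent B" "C \<subseteq> span B"
    using maximal_independent_subset by blast
  have "v \<in> span B" for v
  proof -
    have "(\<Sum>c\<in>C. (v \<bullet> c) *\<^sub>R c) \<in> span B" using B(3) by (intro span_sum span_scale) auto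
    then show ?thesis by (simp add: frame_expansion)
  qed
  then interpret fd: finite_dimensional_vector_space "(*\<^sub>R) :: real \<Rightarrow> 'e \<Rightarrow> 'e" B
    using B finite_subset[OF B(1) finite_frame]
    by unfold_locales (auto simp: algebra_simps dependent_raw_def span_raw_def)
  have "linear (J \<circ> blinfun_apply H)" by (rule linear_compose[OF linH linJ])
  moreover have "inj (J \<circ> blinfun_apply H)"
    by (rule injI) (simp only: comp_apply, rule injD[OF inj injJ])
  ultimately have "surj (J \<circ> blinfun_apply H)"
    unfolding linear_def by (rule fd.linear_inj_imp_surj)
  then have "\<exists>v. J \<alpha> = J (blinfun_apply H v)" for \<alpha>
    unfolding surj_def comp_apply by blast
  then have "surj (blinfun_apply H)" unfolding surj_def using injJ by blast
  with inj show ?thesis by (simp add: bij_def)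
qed

lemma form_apply_form_inv:
  fixes H :: "'e \<Rightarrow>\<^sub>L ('e \<Rightarrow>\<^sub>L real)"
  assumes "positive_definite H"
  shows "blinfun_apply H (form_inv H \<alpha>) = \<alpha>"
  unfolding form_inv_def by (rule surj_f_inv_f[OF bij_is_surj[OF pos_def_form_bij[OF assms]]])

lemma form_inv_form_apply:
  fixes H :: "'e \<Rightarrow>\<^sub>L ('e \<Rightarrow>\<^sub>L real)"
  assumes "positive_definite H"
  shows "form_inv H (blinfun_apply H v) = v"
  unfolding form_inv_def by (rule inv_f_f[OF bij_is_inj[OF pos_def_form_bij[OF assms]]])

lemma bounded_linear_form_inv:
  fixes H :: "'e \<Rightarrow>\<^sub>L ('e \<Rightarrow>\<^sub>L real)"
  assumes "positive_definite H"
  shows "bounded_linear (form_inv H)"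
proof -
  note fi = form_apply_form_inv[OF assms] form_inv_form_apply[OF assms]
  have lin: "linear (form_inv H)"
  proof (rule linearI)
    fix \<alpha> \<beta> :: "'e \<Rightarrow>\<^sub>L real" and t :: real
    show "form_inv H (\<alpha> + \<beta>) = form_inv H \<alpha> + form_inv H \<beta>"
      using fi(2)[of "form_inv H \<alpha> + form_inv H \<beta>"] by (simp add: blinfun.add_right fi(1))
    show "form_inv H (t *\<^sub>R \<alpha>) = t *\<^sub>R form_inv H \<alpha>"
      using fi(2)[of "t *\<^sub>R form_inv H \<alpha>"] by (simp add: blinfun.scaleR_right fi(1))
  qed
  have eq: "form_inv H \<alpha> = (\<Sum>c\<in>C. blinfun_apply \<alpha> c *\<^sub>R form_inv H (blinfun_inner_left c))" for \<alpha>
  proof -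
    have "\<alpha> = (\<Sum>c\<in>C. blinfun_apply \<alpha> c *\<^sub>R blinfun_inner_left c)"
    proof (rule blinfun_eqI)
      fix v
      have "blinfun_apply \<alpha> v = (\<Sum>c\<in>C. (v \<bullet> c) *\<^sub>R blinfun_apply \<alpha> c)"
        by (intro linear_expansion bounded_linear.linear blinfun.bounded_linear_right)
      also have "\<dots> = blinfun_apply (\<Sum>c\<in>C. blinfun_apply \<alpha> c *\<^sub>R blinfun_inner_left c) v"
        by (simp add: blinfun.sum_left blinfun.scaleR_left mult.commute)
      finally show "blinfun_apply \<alpha> v
          = blinfun_apply (\<Sum>c\<in>C. blinfun_apply \<alpha> c *\<^sub>R blinfun_inner_left c) v" .
    qed
    then have "form_inv H \<alpha> = form_inv H (\<Sum>c\<in>C. blinfun_apply \<alpha> c *\<^sub>R blinfun_inner_left c)"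
      by (rule arg_cong)
    then show ?thesis by (simp add: linear_sum[OF lin] linear_cmul[OF lin])
  qed
  have "bounded_linear
      (\<lambda>\<alpha>. \<Sum>c\<in>C. blinfun_apply \<alpha> c *\<^sub>R form_inv H (blinfun_inner_left c))"
    by (intro bounded_linear_sum bounded_linear_scaleR_const blinfun.bounded_linear_left)
  then show ?thesis by (subst ext[OF eq])
qed

text \<open>Inversion is continuous: the equation \<open>H n w = \<beta> n\<close> reads
  \<open>H0 w = \<beta> n - (H n - H0) w\<close>, and the bounded operator \<open>H0\<^sup>-\<^sup>1\<close> first bounds \<open>w\<close>
  and then its distance to the limit.\<close>

lemma tendsto_form_inv:
  fixes H :: "'n \<Rightarrow> 'e \<Rightarrow>\<^sub>L ('e \<Rightarrow>\<^sub>L real)"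
  assumes H: "(H \<longlongrightarrow> H0) F" and \<beta>: "(\<beta> \<longlongrightarrow> \<beta>0) F"
    and pos: "\<forall>\<^sub>F n in F. positive_definite (H n)" and pos0: "positive_definite H0"
  shows "((\<lambda>n. form_inv (H n) (\<beta> n)) \<longlongrightarrow> form_inv H0 \<beta>0) F"
proof -
  interpret L: bounded_linear "form_inv H0" by (rule bounded_linear_form_inv[OF pos0])
  obtain K where K: "K > 0" "\<And>\<alpha>. norm (form_inv H0 \<alpha>) \<le> norm \<alpha> * K"
    using L.pos_bounded by blast
  let ?w = "\<lambda>n. form_inv (H n) (\<beta> n)"
  have lim0: "((\<lambda>n. norm (H n - H0)) \<longlongrightarrow> 0) F"
    using H by (simp add: tendsto_norm_zero LIM_zero)
  have small: "\<forall>\<^sub>F n in F. norm (H n - H0) < 1 / (2 * K)"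
    using order_tendstoD(2)[OF lim0, of "1 / (2 * K)"] K(1) by simp
  have est: "\<forall>\<^sub>F n in F. norm (?w n - form_inv H0 \<beta>0)
      \<le> (norm (\<beta> n - \<beta>0) + norm (H n - H0) * (2 * K * norm (\<beta> n))) * K"
    using small pos
  proof eventually_elim
    case (elim n)
    have "blinfun_apply H0 (?w n) = \<beta> n - blinfun_apply (H n - H0) (?w n)"
      by (simp add: blinfun.diff_left form_apply_form_inv[OF elim(2)])
    then have w: "?w n = form_inv H0 (\<beta> n - blinfun_apply (H n - H0) (?w n))"
      using form_inv_form_apply[OF pos0, of "?w n"] by (simp only:)
    have HW: "norm (blinfun_apply (H n - H0) (?w n)) \<le> norm (H n - H0) * norm (?w n)"
      by (rule norm_blinfun)
    have "norm (?w n) \<le> norm (\<beta> n - blinfun_apply (H n - H0) (?w n)) * K"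
      using K(2)[of "\<beta> n - blinfun_apply (H n - H0) (?w n)"] by (simp only: w[symmetric])
    also have "\<dots> \<le> (norm (\<beta> n) + norm (H n - H0) * norm (?w n)) * K"
      using HW K(1) norm_triangle_ineq4[of "\<beta> n" "blinfun_apply (H n - H0) (?w n)"]
      by (intro mult_right_mono) auto
    also have "\<dots> \<le> norm (\<beta> n) * K + norm (?w n) / 2"
    proof -
      have "norm (H n - H0) * K * norm (?w n) \<le> 1 / 2 * norm (?w n)"
        using elim(1) K(1) by (intro mult_right_mono) (auto simp: field_simps)
      then show ?thesis by (simp add: algebra_simps)
    qed
    finally have wb: "norm (?w n) \<le> 2 * K * norm (\<beta> n)" by (simp add: field_simps)
    have "?w n - form_inv H0 \<beta>0 = form_inv H0 (\<beta> n - \<beta>0 - blinfun_apply (H n - H0) (?w n))"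
      using arg_cong[OF w, of "\<lambda>x. x - form_inv H0 \<beta>0"]
      by (simp only: L.diff) simp
    then have "norm (?w n - form_inv H0 \<beta>0)
        \<le> norm (\<beta> n - \<beta>0 - blinfun_apply (H n - H0) (?w n)) * K"
      using K(2) by simp
    also have "\<dots> \<le> (norm (\<beta> n - \<beta>0) + norm (H n - H0) * (2 * K * norm (\<beta> n))) * K"
    proof (intro mult_right_mono)
      have "norm (H n - H0) * norm (?w n) \<le> norm (H n - H0) * (2 * K * norm (\<beta> n))"
        using wb by (intro mult_left_mono) auto
      then show "norm (\<beta> n - \<beta>0 - blinfun_apply (H n - H0) (?w n))
          \<le> norm (\<beta> n - \<beta>0) + norm (H n - H0) * (2 * K * norm (\<beta> n))"
        using HW norm_triangle_ineq4[of "\<beta> n - \<beta>0" "blinfun_apply (H n - H0) (?w n)"] by linarith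
    qed (use K(1) in simp)
    finally show ?case .
  qed
  have "((\<lambda>n. norm (\<beta> n - \<beta>0)) \<longlongrightarrow> 0) F"
    using \<beta> by (simp add: tendsto_norm_zero LIM_zero)
  then have "((\<lambda>n. (norm (\<beta> n - \<beta>0) + norm (H n - H0) * (2 * K * norm (\<beta> n))) * K)
      \<longlongrightarrow> (0 + 0 * (2 * K * norm \<beta>0)) * K) F"
    by (intro tendsto_intros lim0 \<beta>)
  then have "((\<lambda>n. ?w n - form_inv H0 \<beta>0) \<longlongrightarrow> 0) F"
    by (intro Lim_null_comparison[OF est]) simp
  then show ?thesis by (simp add: LIM_zero_iff)
qed

text \<open>The dual form is the form \<open>H\<close> transported to covectors along the
  bijection \<open>H\<close>, so it inherits symmetry and positivity.\<close>

lemma is_inner_product_dual_form: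
  fixes H :: "'e \<Rightarrow>\<^sub>L ('e \<Rightarrow>\<^sub>L real)"
  assumes pos: "positive_definite H"
    and sym: "\<And>v w. blinfun_apply (blinfun_apply H v) w = blinfun_apply (blinfun_apply H w) v"
  shows "is_inner_product (dual_form H)"
proof -
  note fi = form_apply_form_inv[OF pos]
  have form: "dual_form H \<alpha> \<beta> = blinfun_apply (blinfun_apply H (form_inv H \<alpha>)) (form_inv H \<beta>)" for \<alpha> \<beta>
    by (simp only: dual_form_def fi)
  have "linear (dual_form H \<alpha>)" for \<alpha>
    unfolding dual_form_def
    by (intro bounded_linear.linear bounded_linear_compose[OF blinfun.bounded_linear_right]
        bounded_linear_form_inv[OF pos])
  moreover have "dual_form H \<alpha> \<beta> = dual_form H \<beta> \<alpha>" for \<alpha> \<beta>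
    unfolding form by (rule sym)
  moreover have "dual_form H \<alpha> \<alpha> > 0" if "\<alpha> \<noteq> 0" for \<alpha>
  proof -
    have "form_inv H \<alpha> \<noteq> 0"
    proof
      assume "form_inv H \<alpha> = 0"
      then show False using fi[of \<alpha>] that by simp
    qed
    then show ?thesis unfolding form using pos by (simp add: positive_definite_def)
  qed
  ultimately show ?thesis unfolding is_inner_product_def by (intro conjI allI impI)
qed


end

section \<open>Functions of class \<open>C\<^sup>k\<close>\<close>

lemma has_derivative_fderiv:
  assumes "f differentiable (at x)"
  shows "(f has_derivative blinfun_apply (fderiv f x)) (at x)"
proof -
  have "(f has_derivative frechet_derivative f (at x)) (at x)"
    using assms by (simp add: frechet_derivative_works)
  then show ?thesis
    by (simp add: fderiv_def bounded_linear_Blinfun_apply has_derivative_bounded_linear)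
qed

lemma fderiv_apply:
  assumes "f differentiable (at x)"
  shows "blinfun_apply (fderiv f x) v = frechet_derivative f (at x) v"
  using frechet_derivative_at[OF has_derivative_fderiv[OF assms]] by simp

lemma fderiv_eq:
  assumes "(f has_derivative blinfun_apply f') (at x)"
  shows "fderiv f x = f'"
  unfolding fderiv_def using frechet_derivative_at[OF assms] by (metis blinfun_apply_inverse)

lemma frechet_derivative_cong_open:
  assumes "open S" "x \<in> S" and "\<And>x. x \<in> S \<Longrightarrow> f x = g x"
  shows "frechet_derivative f (at x) = frechet_derivative g (at x)"
proof -
  have "(f has_derivative D) (at x) \<longleftrightarrow> (g has_derivative D) (at x)" for D
    using has_derivative_transform_within_open[OF _ assms(1,2), of f D UNIV g]
      has_derivative_transform_within_open[OF _ assms(1,2), of g D UNIV f] assms(3) by auto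
  then show ?thesis by (simp add: frechet_derivative_def)
qed

lemma differentiable_cong_open:
  assumes "open S" "x \<in> S" and "\<And>x. x \<in> S \<Longrightarrow> f x = g x" and "f differentiable (at x)"
  shows "g differentiable (at x)"
  using assms(4) has_derivative_transform_within_open[OF _ assms(1,2), of f _ UNIV g] assms(3)
  unfolding differentiable_def by auto

lemma Ck_on_cong:
  assumes "open S" and "\<And>x. x \<in> S \<Longrightarrow> f x = g x" and "Ck_on k f S"
  shows "Ck_on k g S"
  using assms(2,3)
proof (induction k arbitrary: f g)
  case 0
  then show ?case using continuous_on_cong[of S S f g] by simp
next
  case (Suc k)
  have "g differentiable (at x)" if "x \<in> S" for x
    using differentiable_cong_open[OF assms(1) that, of f g] Suc.prems that by auto
  moreover have "Ck_on k (\<lambda>x. frechet_derivative g (at x) v) S" for v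
  proof (rule Suc.IH)
    show "Ck_on k (\<lambda>x. frechet_derivative f (at x) v) S" using Suc.prems(2) by simp
    show "frechet_derivative f (at x) v = frechet_derivative g (at x) v" if "x \<in> S" for x
      using frechet_derivative_cong_open[OF assms(1) that, of f g] Suc.prems(1) by simp
  qed
  ultimately show ?case by simp
qed

lemma Ck_on_lower:
  assumes "Ck_on (Suc k) f S"
  shows "Ck_on k f S"
  using assms
proof (induction k arbitrary: f)
  case 0
  then show ?case
    by (auto intro!: continuous_at_imp_continuous_on differentiable_imp_continuous_within)
next
  case (Suc k)
  have "Ck_on (Suc k) (\<lambda>x. frechet_derivative f (at x) v) S" for v
    using Suc.prems by (simp only: Ck_on.simps) blast
  then have "Ck_on k (\<lambda>x. frechet_derivative f (at x) v) S" for v by (rule Suc.IH)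
  then show ?case using Suc.prems by simp
qed

lemma Ck_on_mono:
  assumes "Ck_on m f S" "k \<le> m"
  shows "Ck_on k f S"
  using assms(2)
proof (induction rule: inc_induct)
  case base
  show ?case by (rule assms(1))
next
  case (step n)
  from step.IH show ?case by (rule Ck_on_lower)
qed

text \<open>An explicit family of derivatives replaces \<^const>\<open>frechet_derivative\<close> in the recursion; this
  is the induction step of the closure properties below.\<close>

lemma Ck_on_SucI:
  assumes "open S" and "\<And>x. x \<in> S \<Longrightarrow> (f has_derivative f' x) (at x)"
    and "\<And>v. Ck_on k (\<lambda>x. f' x v) S"
  shows "Ck_on (Suc k) f S"
proof -
  have "Ck_on k (\<lambda>x. frechet_derivative f (at x) v) S" for v
  proof (rule Ck_on_cong[OF assms(1) _ assms(3)])
    show "f' x v = frechet_derivative f (at x) v" if "x \<in> S" for x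
      using frechet_derivative_at[OF assms(2)[OF that]] by simp
  qed
  then show ?thesis using assms(2) by (auto simp: differentiable_def)
qed

lemma Ck_on_Suc_has_derivative:
  assumes "Ck_on (Suc k) f S" "x \<in> S"
  shows "(f has_derivative frechet_derivative f (at x)) (at x)"
  using assms by (simp add: frechet_derivative_works)

lemma Ck_on_const: "open S \<Longrightarrow> Ck_on k (\<lambda>x. c) S"
proof (induction k arbitrary: c)
  case (Suc k)
  show ?case by (rule Ck_on_SucI[OF Suc.prems has_derivative_const Suc.IH[OF Suc.prems]])
qed simp

lemma Ck_on_bounded_linear:
  assumes "open S" "bounded_linear L"
  shows "Ck_on k L S"
proof (cases k)
  case 0
  then show ?thesis using assms(2) by (simp add: linear_continuous_on)
next
  case (Suc m)
  show ?thesis unfolding Suc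
    by (rule Ck_on_SucI[OF assms(1) bounded_linear_imp_has_derivative[OF assms(2)]
          Ck_on_const[OF assms(1)]])
qed

lemma Ck_on_add:
  assumes "open S" "Ck_on k f S" "Ck_on k g S"
  shows "Ck_on k (\<lambda>x. f x + g x) S"
  using assms(2,3)
proof (induction k arbitrary: f g)
  case 0
  then show ?case by (auto intro: continuous_on_add)
next
  case (Suc k)
  show ?case
  proof (rule Ck_on_SucI[OF assms(1)])
    show "((\<lambda>x. f x + g x) has_derivative
        (\<lambda>v. frechet_derivative f (at x) v + frechet_derivative g (at x) v)) (at x)" if "x \<in> S" for x
      by (intro has_derivative_add Ck_on_Suc_has_derivative[OF Suc.prems(1) that]
          Ck_on_Suc_has_derivative[OF Suc.prems(2) that])
    show "Ck_on k (\<lambda>x. frechet_derivative f (at x) v + frechet_derivative g (at x) v) S" for v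
      using Suc.prems by (intro Suc.IH) auto
  qed
qed

lemma Ck_on_sum:
  assumes S: "open S" and f: "\<And>i. i \<in> I \<Longrightarrow> Ck_on k (f i) S"
  shows "Ck_on k (\<lambda>x. \<Sum>i\<in>I. f i x) S"
proof (cases "finite I")
  case True
  then show ?thesis using f
    by (induction I rule: finite_induct) (simp_all add: Ck_on_const[OF S] Ck_on_add[OF S])
qed (simp add: Ck_on_const[OF S])

lemma Ck_on_mult:
  fixes f g :: "'a::real_normed_vector \<Rightarrow> real"
  assumes "open S" "Ck_on k f S" "Ck_on k g S"
  shows "Ck_on k (\<lambda>x. f x * g x) S"
  using assms(2,3)
proof (induction k arbitrary: f g)
  case 0
  then show ?case by (auto intro: continuous_on_mult)
next
  case (Suc k)
  show ?case
  proof (rule Ck_on_SucI[OF assms(1)])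
    show "((\<lambda>x. f x * g x) has_derivative
        (\<lambda>v. f x * frechet_derivative g (at x) v + frechet_derivative f (at x) v * g x)) (at x)"
      if "x \<in> S" for x
      by (intro has_derivative_mult Ck_on_Suc_has_derivative[OF Suc.prems(1) that]
          Ck_on_Suc_has_derivative[OF Suc.prems(2) that])
    show "Ck_on k (\<lambda>x. f x * frechet_derivative g (at x) v + frechet_derivative f (at x) v * g x) S" for v
      using Suc.prems Ck_on_lower[OF Suc.prems(1)] Ck_on_lower[OF Suc.prems(2)]
      by (intro Ck_on_add[OF assms(1)] Suc.IH) auto
  qed
qed

text \<open>Applied to an affine embedding of one factor, this gives the smoothness of a function of several
  variables in each of them separately.\<close>

lemma Ck_on_compose_affine:
  assumes "open T" "bounded_linear L" "\<And>x. x \<in> T \<Longrightarrow> p + L x \<in> S" "Ck_on k f S"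
  shows "Ck_on k (\<lambda>x. f (p + L x)) T"
  using assms(4)
proof (induction k arbitrary: f)
  case 0
  have "continuous_on T (\<lambda>x. p + L x)"
    by (intro continuous_intros linear_continuous_on assms(2))
  then show ?case using 0 assms(3) by (auto intro: continuous_on_compose2)
next
  case (Suc k)
  show ?case
  proof (rule Ck_on_SucI[OF assms(1)])
    fix x assume "x \<in> T"
    have "((\<lambda>x. p + L x) has_derivative L) (at x)"
      using has_derivative_add[OF has_derivative_const bounded_linear_imp_has_derivative[OF assms(2)]]
      by simp
    from has_derivative_compose[OF this Ck_on_Suc_has_derivative[OF Suc.prems assms(3)[OF \<open>x \<in> T\<close>]]]
    show "((\<lambda>x. f (p + L x)) has_derivative (\<lambda>v. frechet_derivative f (at (p + L x)) (L v))) (at x)" .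
  next
    show "Ck_on k (\<lambda>x. frechet_derivative f (at (p + L x)) (L v)) T" for v
      using Suc.prems by (intro Suc.IH) auto
  qed
qed

lemma has_real_derivative_along_line:
  fixes f :: "'a::real_normed_vector \<Rightarrow> real"
  assumes "f differentiable (at (p + s *\<^sub>R w))"
  shows "((\<lambda>s. f (p + s *\<^sub>R w)) has_real_derivative blinfun_apply (fderiv f (p + s *\<^sub>R w)) w) (at s)"
proof -
  have "((\<lambda>s. p + s *\<^sub>R w) has_derivative (\<lambda>h. h *\<^sub>R w)) (at s)"
    by (auto intro!: derivative_eq_intros)
  from has_derivative_compose[OF this has_derivative_fderiv[OF assms]]
  show ?thesis
    by (simp add: has_field_derivative_def blinfun.scaleR_right mult.commute[of _ "blinfun_apply _ _"])
qed

lemma partial_eq: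
  assumes "(f has_derivative f') (at u)"
  shows "partial i f u = f' (axis i 1)"
proof -
  have "f differentiable (at (u + 0 *\<^sub>R axis i 1))" using assms by (auto intro: differentiableI)
  note d = DERIV_imp_deriv[OF has_real_derivative_along_line[OF this]]
  have "blinfun_apply (fderiv f u) (axis i 1) = f' (axis i 1)"
    using fderiv_apply[OF differentiableI[OF assms]] frechet_derivative_at[OF assms] by simp
  with d show ?thesis by (simp add: partial_def)
qed

section \<open>Second derivatives\<close>

context parseval_frame
begin

lemma bounded_linear_rank_one:
  "bounded_linear (\<lambda>b. blinfun_scaleR_left b o\<^sub>L blinfun_inner_left (c::'e))"
  by (intro bounded_linear_intros)

text \<open>The class \<open>C\<^sup>2\<close> is defined by directional derivatives. On a finite-dimensional space
  finitely many directions determine the total derivative, so the latter is differentiable as an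
  operator-valued function.\<close>

lemma
  assumes S: "open S" and f: "Ck_on 2 (f :: 'e \<Rightarrow> 'b::real_normed_vector) S" and x: "x \<in> S"
  shows has_derivative_fderiv2: "(fderiv f has_derivative blinfun_apply (fderiv2 f x)) (at x)"
    and fderiv2_apply: "blinfun_apply (blinfun_apply (fderiv2 f x) v) w
      = frechet_derivative (\<lambda>x. frechet_derivative f (at x) w) (at x) v"
proof -
  let ?D = "\<lambda>w x. frechet_derivative f (at x) w"
  let ?F = "\<lambda>x. \<Sum>c\<in>C. blinfun_scaleR_left (?D c x) o\<^sub>L blinfun_inner_left c"
  have diff: "f differentiable (at z)" if "z \<in> S" for z
    using f that by (simp add: numeral_2_eq_2)
  have D: "(?D w has_derivative frechet_derivative (?D w) (at x)) (at x)" for w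
    by (rule iffD1[OF frechet_derivative_works]) (use f x in \<open>simp add: numeral_2_eq_2\<close>)
  have eq: "?F z = fderiv f z" if "z \<in> S" for z
    using blinfun_expansion[of "fderiv f z"]
    by (simp add: coords_blinfun_def fderiv_apply[OF diff[OF that]])
  have "(?F has_derivative (\<lambda>v. \<Sum>c\<in>C. blinfun_scaleR_left (frechet_derivative (?D c) (at x) v)
      o\<^sub>L blinfun_inner_left c)) (at x)"
    by (intro has_derivative_sum bounded_linear.has_derivative[OF bounded_linear_rank_one] D)
  from differentiable_cong_open[OF S x _ differentiableI[OF this], of "fderiv f"]
  have "fderiv f differentiable (at x)" using eq by simp
  then show 1: "(fderiv f has_derivative blinfun_apply (fderiv2 f x)) (at x)"
    unfolding fderiv2_def by (rule has_derivative_fderiv)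
  have "((\<lambda>z. blinfun_apply (fderiv f z) w) has_derivative
      (\<lambda>v. blinfun_apply (blinfun_apply (fderiv2 f x) v) w)) (at x)"
    by (rule bounded_linear.has_derivative[OF blinfun.bounded_linear_left 1])
  then have "(?D w has_derivative (\<lambda>v. blinfun_apply (blinfun_apply (fderiv2 f x) v) w)) (at x)"
    by (rule has_derivative_transform_within_open[OF _ S x]) (simp add: fderiv_apply diff)
  from fun_cong[OF frechet_derivative_at[OF this]]
  show "blinfun_apply (blinfun_apply (fderiv2 f x) v) w = frechet_derivative (?D w) (at x) v" .
qed

lemma continuous_on_fderiv2:
  assumes S: "open S" and f: "Ck_on 2 (f :: 'e \<Rightarrow> 'b::real_normed_vector) S"
  shows "continuous_on S (fderiv2 f)"
proof -
  let ?D = "\<lambda>w x. frechet_derivative f (at x) w"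
  let ?F = "\<lambda>x. \<Sum>c\<in>C. blinfun_scaleR_left (\<Sum>d\<in>C. blinfun_scaleR_left
    (frechet_derivative (?D d) (at x) c) o\<^sub>L blinfun_inner_left d) o\<^sub>L blinfun_inner_left c"
  have "?F x = fderiv2 f x" if x: "x \<in> S" for x
  proof -
    have "fderiv2 f x = coords_blinfun (\<lambda>c. coords_blinfun (\<lambda>d. blinfun_apply (blinfun_apply (fderiv2 f x) c) d))"
      unfolding blinfun_expansion ..
    then show ?thesis unfolding coords_blinfun_def fderiv2_apply[OF S f x] by (rule sym)
  qed
  note eq = this
  have "continuous_on S (\<lambda>x. frechet_derivative (?D d) (at x) c)" for c d
    using f by (simp add: numeral_2_eq_2)
  then have "continuous_on S (\<lambda>x. \<Sum>d\<in>C. blinfun_scaleR_left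
      (frechet_derivative (?D d) (at x) c) o\<^sub>L blinfun_inner_left d)" for c
    by (rule continuous_on_sum[OF bounded_linear.continuous_on[OF bounded_linear_rank_one]])
  then have "continuous_on S ?F"
    by (rule continuous_on_sum[OF bounded_linear.continuous_on[OF bounded_linear_rank_one]])
  moreover have "continuous_on S ?F \<longleftrightarrow> continuous_on S (fderiv2 f)"
    by (rule continuous_on_cong[OF refl]) (rule eq)
  ultimately show ?thesis by (rule iffD1[rotated])
qed

text \<open>The mean value theorem is applied once, to the difference of \<open>f\<close> along two parallel segments in direction
  \<open>w\<close>; the differentiability of \<^term>\<open>fderiv f\<close> at \<open>x\<close> then evaluates the resulting difference
  of first derivatives.\<close>

lemma second_difference_estimate:
  fixes f :: "'e \<Rightarrow> real"
  assumes S: "open S" and f: "Ck_on 2 f S" and x: "x \<in> S" and "e > 0"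
  shows "\<exists>d>0. \<forall>t. 0 < t \<and> t < d \<longrightarrow>
    \<bar>f (x + t *\<^sub>R v + t *\<^sub>R w) - f (x + t *\<^sub>R v) - f (x + t *\<^sub>R w) + f x
      - t\<^sup>2 * blinfun_apply (blinfun_apply (fderiv2 f x) v) w\<bar> \<le> e * t\<^sup>2"
proof -
  define N where "N = norm v + norm w"
  define e' where "e' = e / (2 * N * norm w + 1)"
  have N: "N \<ge> 0" "norm v \<le> N" by (auto simp: N_def)
  have pos: "2 * N * norm w + 1 > 0" using N by (simp add: add_nonneg_pos)
  have e': "e' > 0" "2 * e' * N * norm w \<le> e"
    using \<open>e > 0\<close> pos by (auto simp: e'_def field_simps)
  let ?B = "fderiv2 f x"
  have diff: "f differentiable (at z)" if "z \<in> S" for z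
    using f that by (simp add: numeral_2_eq_2)
  obtain d1 where d1: "d1 > 0" "\<And>z. norm (z - x) < d1 \<Longrightarrow>
      norm (fderiv f z - fderiv f x - blinfun_apply ?B (z - x)) \<le> e' * norm (z - x)"
    using has_derivative_fderiv2[OF S f x] e'(1) unfolding has_derivative_at_alt by blast
  obtain d2 where d2: "d2 > 0" "ball x d2 \<subseteq> S" using S x open_contains_ball by blast
  define d where "d = min d1 d2 / (N + 1)"
  have "d > 0" using d1 d2 N by (simp add: d_def add_nonneg_pos)
  moreover have "\<bar>f (x + t *\<^sub>R v + t *\<^sub>R w) - f (x + t *\<^sub>R v) - f (x + t *\<^sub>R w) + f x
      - t\<^sup>2 * blinfun_apply (blinfun_apply ?B v) w\<bar> \<le> e * t\<^sup>2" if t: "0 < t" "t < d" for t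
  proof -
    have tN: "t * N < min d1 d2"
    proof -
      have "t * N \<le> t * (N + 1)" using t by (simp add: algebra_simps)
      also have "\<dots> < min d1 d2" using t N by (simp add: d_def pos_less_divide_eq add_nonneg_pos)
      finally show ?thesis .
    qed
    have nrm: "norm (r *\<^sub>R v + s *\<^sub>R w) \<le> t * N" if "0 \<le> r" "r \<le> t" "0 \<le> s" "s \<le> t" for r s
    proof -
      have "norm (r *\<^sub>R v + s *\<^sub>R w) \<le> r * norm v + s * norm w"
        using that norm_triangle_ineq[of "r *\<^sub>R v" "s *\<^sub>R w"] by simp
      also have "\<dots> \<le> t * norm v + t * norm w"
        using that by (intro add_mono mult_right_mono) auto
      finally show ?thesis by (simp add: N_def algebra_simps)
    qed
    have inS: "x + r *\<^sub>R v + s *\<^sub>R w \<in> S" if "0 \<le> r" "r \<le> t" "0 \<le> s" "s \<le> t" for r s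
    proof -
      have "dist x (x + r *\<^sub>R v + s *\<^sub>R w) = norm (r *\<^sub>R v + s *\<^sub>R w)"
        by (simp only: dist_norm norm_minus_commute[of x]) (simp add: add.assoc)
      then show ?thesis using nrm[OF that] tN d2(2) by auto
    qed
    have inS0: "x + s *\<^sub>R w \<in> S" if "0 \<le> s" "s \<le> t" for s
      using inS[of 0 s] that t by simp
    define \<phi> where "\<phi> = (\<lambda>s. f (x + t *\<^sub>R v + s *\<^sub>R w) - f (x + s *\<^sub>R w))"
    define \<phi>' where "\<phi>' = (\<lambda>s. blinfun_apply (fderiv f (x + t *\<^sub>R v + s *\<^sub>R w)) w
        - blinfun_apply (fderiv f (x + s *\<^sub>R w)) w)"
    have "(\<phi> has_real_derivative \<phi>' s) (at s)" if "0 \<le> s" "s \<le> t" for s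
      unfolding \<phi>_def \<phi>'_def
      by (intro DERIV_diff has_real_derivative_along_line diff inS inS0) (use that t in auto)
    then obtain \<xi> where \<xi>: "0 < \<xi>" "\<xi> < t" "\<phi> t - \<phi> 0 = (t - 0) * \<phi>' \<xi>"
      using MVT2[of 0 t \<phi> \<phi>'] t by blast
    let ?r = "\<lambda>z. fderiv f z - fderiv f x - blinfun_apply ?B (z - x)"
    let ?p = "x + t *\<^sub>R v + \<xi> *\<^sub>R w" and ?q = "x + \<xi> *\<^sub>R w"
    have pd: "norm (?p - x) \<le> t * N" using nrm[of t \<xi>] \<xi> t by (simp add: algebra_simps)
    have qd: "norm (?q - x) \<le> t * N" using nrm[of 0 \<xi>] \<xi> t by (simp add: algebra_simps)
    have rp: "norm (?r ?p) \<le> e' * (t * N)"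
      by (rule order_trans[OF d1(2)]) (use pd tN e' in \<open>auto intro: mult_left_mono\<close>)
    have rq: "norm (?r ?q) \<le> e' * (t * N)"
      by (rule order_trans[OF d1(2)]) (use qd tN e' in \<open>auto intro: mult_left_mono\<close>)
    have pq: "?p - x = t *\<^sub>R v + (?q - x)" by (simp add: algebra_simps)
    have "\<phi>' \<xi> = blinfun_apply (fderiv f ?p - fderiv f ?q) w"
      by (simp add: \<phi>'_def blinfun.diff_left)
    also have "fderiv f ?p - fderiv f ?q = t *\<^sub>R blinfun_apply ?B v + (?r ?p - ?r ?q)"
      unfolding pq by (simp add: blinfun.add_right blinfun.scaleR_right)
    finally have \<phi>': "\<phi>' \<xi> = t * blinfun_apply (blinfun_apply ?B v) w
        + blinfun_apply (?r ?p - ?r ?q) w"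
      by (simp only: blinfun.add_left blinfun.scaleR_left real_scaleR_def)
    have "\<bar>blinfun_apply (?r ?p - ?r ?q) w\<bar> \<le> norm (?r ?p - ?r ?q) * norm w"
      using norm_blinfun[of "?r ?p - ?r ?q" w] by (simp only: real_norm_def)
    also have "\<dots> \<le> (2 * (e' * (t * N))) * norm w"
      using norm_triangle_ineq4[of "?r ?p" "?r ?q"] rp rq by (intro mult_right_mono) auto
    also have "\<dots> = (2 * e' * N * norm w) * t" by simp
    also have "\<dots> \<le> e * t" using e'(2) t by (intro mult_right_mono) auto
    finally have R: "\<bar>blinfun_apply (?r ?p - ?r ?q) w\<bar> \<le> e * t" .
    have "f (x + t *\<^sub>R v + t *\<^sub>R w) - f (x + t *\<^sub>R v) - f (x + t *\<^sub>R w) + f x = \<phi> t - \<phi> 0"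
      by (simp add: \<phi>_def)
    also have "\<dots> - t\<^sup>2 * blinfun_apply (blinfun_apply ?B v) w = t * blinfun_apply (?r ?p - ?r ?q) w"
      unfolding \<xi>(3) \<phi>' by (simp only: power2_eq_square) (simp only: algebra_simps diff_0_right)
    also have "\<bar>\<dots>\<bar> \<le> t * (e * t)"
      unfolding abs_mult using R t by (intro mult_mono) auto
    finally show ?thesis by (simp add: power2_eq_square mult_ac)
  qed
  ultimately show ?thesis by blast
qed

text \<open>Second differences are symmetric in the two directions, and both values of the
  second derivative are their limit after division by \<open>t\<^sup>2\<close>.\<close>

lemma fderiv2_symmetric:
  fixes f :: "'e \<Rightarrow> real"
  assumes S: "open S" and f: "Ck_on 2 f S" and x: "x \<in> S"
  shows "blinfun_apply (blinfun_apply (fderiv2 f x) v) w = blinfun_apply (blinfun_apply (fderiv2 f x) w) v"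
    (is "?a = ?b")
proof -
  have "\<bar>?a - ?b\<bar> \<le> 0 + e" if "e > 0" for e
  proof -
    let ?Q = "\<lambda>t. f (x + t *\<^sub>R v + t *\<^sub>R w) - f (x + t *\<^sub>R v) - f (x + t *\<^sub>R w) + f x"
    obtain d1 where d1: "d1 > 0" "\<And>t. 0 < t \<Longrightarrow> t < d1 \<Longrightarrow> \<bar>?Q t - t\<^sup>2 * ?a\<bar> \<le> e / 2 * t\<^sup>2"
      using second_difference_estimate[OF S f x, of "e / 2" v w] \<open>e > 0\<close> by auto
    obtain d2 where d2: "d2 > 0" "\<And>t. 0 < t \<Longrightarrow> t < d2 \<Longrightarrow>
        \<bar>f (x + t *\<^sub>R w + t *\<^sub>R v) - f (x + t *\<^sub>R w) - f (x + t *\<^sub>R v) + f x - t\<^sup>2 * ?b\<bar> \<le> e / 2 * t\<^sup>2"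
      using second_difference_estimate[OF S f x, of "e / 2" w v] \<open>e > 0\<close> by auto
    define t where "t = min d1 d2 / 2"
    have t: "0 < t" "t < d1" "t < d2" using d1 d2 by (auto simp: t_def)
    have swap: "f (x + t *\<^sub>R w + t *\<^sub>R v) - f (x + t *\<^sub>R w) - f (x + t *\<^sub>R v) + f x = ?Q t"
      by (simp add: add.assoc add.commute[of "t *\<^sub>R w"])
    have "\<bar>t\<^sup>2 * ?a - t\<^sup>2 * ?b\<bar> \<le> e / 2 * t\<^sup>2 + e / 2 * t\<^sup>2"
      using d1(2)[OF t(1,2)] d2(2)[OF t(1,3)] unfolding swap by linarith
    then have "t\<^sup>2 * \<bar>?a - ?b\<bar> \<le> t\<^sup>2 * e"
      by (simp add: right_diff_distrib[symmetric] abs_mult mult.commute)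
    then show ?thesis using t(1) by simp
  qed
  then have "\<bar>?a - ?b\<bar> \<le> 0" by (rule field_le_epsilon)
  then show ?thesis by simp
qed

end

lemma (in parseval_frame) fderiv2_affine_combination:
  fixes f :: "'e \<Rightarrow> real" and D :: "'i::finite \<Rightarrow> 'e \<Rightarrow> real"
  assumes V: "open V" and f: "Ck_on 2 f V" and D: "\<And>i. Ck_on 2 (D i) V" and x: "x \<in> V"
  shows "fderiv2 (\<lambda>x. f x + (\<Sum>i\<in>UNIV. t i * D i x)) x
    = fderiv2 f x + (\<Sum>i\<in>UNIV. t i *\<^sub>R fderiv2 (D i) x)"
proof -
  let ?g = "\<lambda>x. f x + (\<Sum>i\<in>UNIV. t i * D i x)"
  let ?F = "\<lambda>z. fderiv f z + (\<Sum>i\<in>UNIV. t i *\<^sub>R fderiv (D i) z)"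
  have diff: "f differentiable (at z)" "D i differentiable (at z)" if "z \<in> V" for z i
    using f D that by (simp_all add: numeral_2_eq_2)
  have "?F z = fderiv ?g z" if z: "z \<in> V" for z
  proof -
    have "(?g has_derivative blinfun_apply (?F z)) (at z)"
      by (auto intro!: derivative_eq_intros has_derivative_fderiv diff z
          simp: fun_eq_iff blinfun.add_left blinfun.sum_left blinfun.scaleR_left)
    then show ?thesis by (rule fderiv_eq[symmetric])
  qed
  note eq = this
  have "(?F has_derivative (\<lambda>h. blinfun_apply (fderiv2 f x) h
      + (\<Sum>i\<in>UNIV. t i *\<^sub>R blinfun_apply (fderiv2 (D i) x) h))) (at x)"
    by (intro has_derivative_add has_derivative_sum has_derivative_scaleR_right
        has_derivative_fderiv2[OF V f x] has_derivative_fderiv2[OF V D x])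
  then have "(?F has_derivative blinfun_apply (fderiv2 f x + (\<Sum>i\<in>UNIV. t i *\<^sub>R fderiv2 (D i) x))) (at x)"
    by (simp add: blinfun.add_left[abs_def] blinfun.sum_left[abs_def] blinfun.scaleR_left)
  then have "(fderiv ?g has_derivative blinfun_apply (fderiv2 f x + (\<Sum>i\<in>UNIV. t i *\<^sub>R fderiv2 (D i) x))) (at x)"
    by (rule has_derivative_transform_within_open[OF _ V x]) (rule eq)
  then show ?thesis unfolding fderiv2_def[of ?g] by (rule fderiv_eq)
qed

section \<open>Differentiating a solution of an equation\<close>

text \<open>This is the differentiability half of the implicit function theorem. The existence half is replaced
  by the assumption that a continuous solution \<open>X\<close> is at hand. Applying \<open>L\<close> to the first-order expansion of
  \<open>\<Phi>\<close> gives \<open>\<delta>X = - L (B (\<delta>u)) + o(\<bar>\<delta>X\<bar> + \<bar>\<delta>u\<bar>)\<close>, and the increment \<open>\<delta>X\<close> on the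
  right can be absorbed.\<close>

lemma implicit_has_derivative:
  fixes X :: "'u::real_normed_vector \<Rightarrow> 'e::real_normed_vector"
    and \<Phi> :: "'e \<times> 'u \<Rightarrow> 'f::real_normed_vector"
  assumes X: "isCont X u0" and zero: "\<forall>\<^sub>F u in nhds u0. \<Phi> (X u, u) = 0"
    and \<Phi>: "(\<Phi> has_derivative (\<lambda>(k, h). A k + B h)) (at (X u0, u0))"
    and B: "bounded_linear B" and L: "bounded_linear L" "\<And>k. L (A k) = k"
  shows "(X has_derivative (\<lambda>h. - L (B h))) (at u0)"
proof -
  interpret L: bounded_linear L by fact
  obtain K where K: "K > 0" "\<And>a. norm (L a) \<le> norm a * K" using L.pos_bounded by blast
  have LB: "bounded_linear (\<lambda>h. L (B h))" by (rule bounded_linear_compose[OF L(1) B])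
  then obtain M where M: "M > 0" "\<And>h. norm (L (B h)) \<le> norm h * M"
    using bounded_linear.pos_bounded by blast
  have zero0: "\<Phi> (X u0, u0) = 0" using zero by (rule eventually_nhds_x_imp_x)
  have est: "\<exists>d>0. \<forall>u. norm (u - u0) < d \<longrightarrow>
      norm (X u - X u0 + L (B (u - u0))) \<le> e * (norm (X u - X u0) + norm (u - u0))"
    if "e > 0" for e
  proof -
    have "e / K > 0" using that K by simp
    then obtain d1 where d1: "d1 > 0" "\<And>z. norm (z - (X u0, u0)) < d1 \<Longrightarrow>
        norm (\<Phi> z - \<Phi> (X u0, u0) - (\<lambda>(k, h). A k + B h) (z - (X u0, u0)))
          \<le> e / K * norm (z - (X u0, u0))"
      using \<Phi> unfolding has_derivative_at_alt by blast
    obtain d2 where d2: "d2 > 0" "\<And>u. dist u u0 < d2 \<Longrightarrow> \<Phi> (X u, u) = 0"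
      using zero unfolding eventually_nhds_metric by blast
    obtain d3 where d3: "d3 > 0" "\<And>u. dist u u0 < d3 \<Longrightarrow> dist (X u) (X u0) < d1 / 2"
      using X d1(1) unfolding continuous_at_eps_delta by (metis half_gt_zero)
    have "norm (X u - X u0 + L (B (u - u0))) \<le> e * (norm (X u - X u0) + norm (u - u0))"
      if u: "norm (u - u0) < Min {d2, d3, d1 / 2}" for u
    proof -
      have "norm ((X u, u) - (X u0, u0)) \<le> norm (X u - X u0) + norm (u - u0)"
        using norm_Pair_le[of "X u - X u0" "u - u0"] by simp
      moreover have "norm (X u - X u0) < d1 / 2" using d3(2)[of u] u by (simp add: dist_norm)
      ultimately have n: "norm ((X u, u) - (X u0, u0)) \<le> norm (X u - X u0) + norm (u - u0)"
        "norm ((X u, u) - (X u0, u0)) < d1" using u by auto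
      have "\<Phi> (X u, u) = 0" using d2(2)[of u] u by (simp add: dist_norm)
      then have "norm (A (X u - X u0) + B (u - u0)) \<le> e / K * norm ((X u, u) - (X u0, u0))"
        using d1(2)[OF n(2)] zero0
          norm_minus_cancel[of "A (X u - X u0) + B (u - u0)"] by simp
      also have "\<dots> \<le> e / K * (norm (X u - X u0) + norm (u - u0))"
        using n(1) that \<open>e / K > 0\<close> by (intro mult_left_mono) auto
      finally have *: "norm (A (X u - X u0) + B (u - u0)) * K
          \<le> e * (norm (X u - X u0) + norm (u - u0))"
        using K(1) by (simp add: field_simps)
      have "X u - X u0 + L (B (u - u0)) = L (A (X u - X u0) + B (u - u0))"
        by (simp add: L.add L(2))
      then show ?thesis using K(2)[of "A (X u - X u0) + B (u - u0)"] * by simp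
    qed
    moreover have "Min {d2, d3, d1 / 2} > 0" using d1 d2 d3 by simp
    ultimately show ?thesis by blast
  qed
  show ?thesis unfolding has_derivative_at_alt
  proof (intro conjI allI impI)
    show "bounded_linear (\<lambda>h. - L (B h))" by (rule bounded_linear_minus[OF LB])
    fix e :: real assume "e > 0"
    \<comment> \<open>The estimate with constant \<open>1/2\<close> bounds the increment of \<open>X\<close> linearly in \<open>u - u0\<close>; the estimate
      with a small constant then becomes the differentiability of \<open>X\<close>.\<close>
    obtain d1 where d1: "d1 > 0" "\<And>u. norm (u - u0) < d1 \<Longrightarrow>
        norm (X u - X u0 + L (B (u - u0))) \<le> 1 / 2 * (norm (X u - X u0) + norm (u - u0))"
      using est[of "1 / 2"] by auto
    obtain d2 where d2: "d2 > 0" "\<And>u. norm (u - u0) < d2 \<Longrightarrow>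
        norm (X u - X u0 + L (B (u - u0))) \<le> e / (2 * M + 2) * (norm (X u - X u0) + norm (u - u0))"
      using est[of "e / (2 * M + 2)"] M(1) \<open>e > 0\<close> by auto
    have "norm (X u - X u0 - - L (B (u - u0))) \<le> e * norm (u - u0)"
      if u: "norm (u - u0) < min d1 d2" for u
    proof -
      have "norm (X u - X u0) \<le> norm (X u - X u0 + L (B (u - u0))) + norm (L (B (u - u0)))"
        using norm_triangle_ineq4[of "X u - X u0 + L (B (u - u0))" "L (B (u - u0))"] by simp
      moreover have "norm (X u - X u0 + L (B (u - u0))) \<le> 1 / 2 * (norm (X u - X u0) + norm (u - u0))"
        using d1(2) u by simp
      ultimately have lip: "norm (X u - X u0) + norm (u - u0) \<le> (2 * M + 2) * norm (u - u0)"
        using M(2)[of "u - u0"] by (simp add: algebra_simps)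
      have "norm (X u - X u0 + L (B (u - u0))) \<le> e / (2 * M + 2) * (norm (X u - X u0) + norm (u - u0))"
        using d2(2) u by simp
      also have "\<dots> \<le> e / (2 * M + 2) * ((2 * M + 2) * norm (u - u0))"
        using lip M(1) \<open>e > 0\<close> by (intro mult_left_mono) auto
      also have "\<dots> = e * norm (u - u0)" using M(1) by simp
      finally show ?thesis by simp
    qed
    then show "\<exists>d>0. \<forall>u. norm (u - u0) < d \<longrightarrow> norm (X u - X u0 - - L (B (u - u0))) \<le> e * norm (u - u0)"
      using d1(1) d2(1) by (intro exI[of _ "min d1 d2"]) auto
  qed
qed

context parseval_frame
begin

text \<open>A continuous family of minimizers solves the critical point equation
  \<open>D f x + \<Sum>\<^sub>i (u\<^sub>i - u0\<^sub>i) D (D\<^sub>i) x = 0\<close>. At \<open>u0\<close> the derivative of its left-hand side is the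
  Hessian in \<open>x\<close> and the combination of the differentials of the \<open>D\<^sub>i\<close> in \<open>u\<close>.\<close>

lemma has_derivative_local_minimizer:
  fixes f :: "'e \<Rightarrow> real" and D :: "'p::finite \<Rightarrow> 'e \<Rightarrow> real" and X :: "real^'p \<Rightarrow> 'e"
  assumes V: "open V" and f: "Ck_on 2 f V" and D: "\<And>i. Ck_on 2 (D i) V"
    and X: "isCont X u0" "X u0 \<in> V" and pos: "positive_definite (fderiv2 f (X u0))"
    and min: "\<forall>\<^sub>F u in nhds u0. \<forall>x\<in>V. f (X u) + (\<Sum>i\<in>UNIV. (u $ i - u0 $ i) * D i (X u))
      \<le> f x + (\<Sum>i\<in>UNIV. (u $ i - u0 $ i) * D i x)"
  shows "(X has_derivative (\<lambda>h. - form_inv (fderiv2 f (X u0))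
      (\<Sum>i\<in>UNIV. h $ i *\<^sub>R fderiv (D i) (X u0)))) (at u0)"
proof -
  define \<Phi> where "\<Phi> = (\<lambda>(x, u). fderiv f x + (\<Sum>i\<in>UNIV. (u $ i - u0 $ i) *\<^sub>R fderiv (D i) x))"
  have diff: "f differentiable (at z)" "D i differentiable (at z)" if "z \<in> V" for z i
    using f D that by (simp_all add: numeral_2_eq_2)
  have inV: "\<forall>\<^sub>F u in nhds u0. X u \<in> V"
    using X V by (auto simp: isCont_def tendsto_at_iff_tendsto_nhds intro: topological_tendstoD)
  have "\<forall>\<^sub>F u in nhds u0. \<Phi> (X u, u) = 0"
    using min inV
  proof eventually_elim
    case (elim u)
    have "((\<lambda>x. f x + (\<Sum>i\<in>UNIV. (u $ i - u0 $ i) * D i x)) has_derivative blinfun_apply (\<Phi> (X u, u))) (at (X u))"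
      unfolding \<Phi>_def
      by (auto intro!: derivative_eq_intros has_derivative_fderiv diff elim
          simp: fun_eq_iff blinfun.add_left blinfun.sum_left blinfun.scaleR_left)
    from differential_zero_maxmin[OF elim(2) V this] elim(1)
    show ?case by (auto intro: blinfun_eqI)
  qed
  moreover have "(\<Phi> has_derivative (\<lambda>(k, h). blinfun_apply (fderiv2 f (X u0)) k
      + (\<Sum>i\<in>UNIV. h $ i *\<^sub>R fderiv (D i) (X u0)))) (at (X u0, u0))"
  proof -
    let ?z = "(X u0, u0)"
    have d: "((\<lambda>z. fderiv g (fst z)) has_derivative (\<lambda>z. blinfun_apply (fderiv2 g (X u0)) (fst z))) (at ?z)"
      if "Ck_on 2 g V" for g :: "'e \<Rightarrow> real"
      by (rule has_derivative_compose[OF has_derivative_fst[OF has_derivative_ident]])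
         (use has_derivative_fderiv2[OF V that X(2)] in simp)
    have c: "((\<lambda>z. snd z $ i - u0 $ i) has_derivative (\<lambda>z. snd z $ i)) (at ?z)" for i
      by (auto intro!: derivative_eq_intros bounded_linear.has_derivative[OF bounded_linear_vec_nth])
    have "((\<lambda>z. (snd z $ i - u0 $ i) *\<^sub>R fderiv (D i) (fst z)) has_derivative
        (\<lambda>z. snd z $ i *\<^sub>R fderiv (D i) (X u0))) (at ?z)" for i
      using has_derivative_scaleR[OF c d[OF D[of i]], of i] by simp
    then show ?thesis unfolding \<Phi>_def case_prod_beta
      by (intro has_derivative_add has_derivative_sum d[OF f])
  qed
  moreover have "bounded_linear (\<lambda>h::real^'p. \<Sum>i\<in>UNIV. h $ i *\<^sub>R fderiv (D i) (X u0))"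
    by (intro bounded_linear_sum bounded_linear_scaleR_const bounded_linear_vec_nth)
  ultimately show ?thesis
    by (rule implicit_has_derivative[OF X(1) _ _ _ bounded_linear_form_inv[OF pos]
          form_inv_form_apply[OF pos]])
qed

end

section \<open>Functions in charts\<close>

lemma chart_inv_coord:
  assumes "is_chart c" "s \<in> fst c"
  shows "chart_inv c (snd c s) = s"
proof -
  have "inj_on (snd c) (fst c)"
    using assms(1) unfolding is_chart_def homeomorphism_def by (metis inj_on_def)
  then show ?thesis unfolding chart_inv_def using assms(2) by (rule inv_into_f_f)
qed

lemma continuous_on_chart:
  assumes "is_chart c"
  shows "continuous_on (fst c) (snd c)"
  using assms unfolding is_chart_def homeomorphism_def by blast

lemma continuous_on_points:
  assumes A: "\<And>c. c \<in> A \<Longrightarrow> is_chart c"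
    and f: "\<And>c. c \<in> A \<Longrightarrow> continuous_on (snd c ` fst c) (f \<circ> chart_inv c)"
  shows "continuous_on (points A) f"
  unfolding points_def
proof (rule continuous_on_open_UN)
  fix c assume c: "c \<in> A"
  show "open (fst c)" using A[OF c] by (simp add: is_chart_def)
  have "continuous_on (fst c) ((f \<circ> chart_inv c) \<circ> snd c)"
    by (rule continuous_on_compose[OF continuous_on_chart[OF A[OF c]] f[OF c]])
  moreover have "((f \<circ> chart_inv c) \<circ> snd c) s = f s" if "s \<in> fst c" for s
    using chart_inv_coord[OF A[OF c] that] by simp
  ultimately show "continuous_on (fst c) f"
    using continuous_on_cong[OF refl, of "fst c" "(f \<circ> chart_inv c) \<circ> snd c" f] by blast
qed

lemma open_points: "(\<And>c. c \<in> A \<Longrightarrow> is_chart c) \<Longrightarrow> open (points A)"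
  unfolding points_def is_chart_def by blast

text \<open>The energy is affine in the parameter: every comparison of two parameters below rests on this.\<close>

lemma energy_shift:
  "energy E0 \<Delta> y s v = energy E0 \<Delta> y s u + (\<Sum>i\<in>UNIV. (v $ i - u $ i) * \<Delta> i y s)"
  unfolding energy_def by (simp add: left_diff_distrib sum_subtractf)

section \<open>The minimizer and the envelope formula\<close>

text \<open>The base point \<open>y\<close> is fixed; the assertion concerns one fiber at a time.\<close>

locale affine_energy =
  fixes r :: nat
    and AY :: "('y::{t2_space,second_countable_topology}, 'ey::real_inner) atlas"
    and AS :: "('s::{t2_space,second_countable_topology}, 'es::real_inner) atlas"
    and U :: "(real^'p::finite) set"
    and E0 :: "'y \<Rightarrow> 's \<Rightarrow> real"
    and \<Delta> :: "'p \<Rightarrow> 'y \<Rightarrow> 's \<Rightarrow> real"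
    and y :: 'y
  assumes family: "energy_family r AY AS U E0 \<Delta>" and y: "y \<in> points AY"
begin

abbreviation E :: "'s \<Rightarrow> real^'p \<Rightarrow> real" where "E \<equiv> energy E0 \<Delta> y"

abbreviation \<sigma> :: "real^'p \<Rightarrow> 's" where "\<sigma> \<equiv> minimizer (points AS) E0 \<Delta> y"

abbreviation Ebar :: "real^'p \<Rightarrow> real" where "Ebar \<equiv> reduced_energy (points AS) E0 \<Delta> y"

lemma
  shows regularity: "2 \<le> r"
    and atlases: "smooth_atlas AY" "smooth_atlas AS"
    and open_U: "open U"
    and smooth_energy: "\<forall>c\<in>AY. \<forall>d\<in>AS.
        Ck_on (r + 1) (\<lambda>(a, x, u). energy E0 \<Delta> (chart_inv c a) (chart_inv d x) u)
          ((snd c ` fst c) \<times> (snd d ` fst d) \<times> U)"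
    and coercive: "\<forall>K e. compact K \<and> K \<subseteq> points AY \<times> U \<longrightarrow>
        relatively_compact_in (points AS)
          {s \<in> points AS. \<exists>(y, u)\<in>K. energy E0 \<Delta> y s u \<le> e}"
    and minimizers: "\<forall>y\<in>points AY. \<forall>u\<in>U.
        (\<exists>!s. is_arg_min (\<lambda>s. energy E0 \<Delta> y s u) (\<lambda>s. s \<in> points AS) s) \<and>
        (\<forall>d\<in>AS. minimizer (points AS) E0 \<Delta> y u \<in> fst d \<longrightarrow>
           positive_definite
             (chart_hessian d (\<lambda>s. energy E0 \<Delta> y s u) (minimizer (points AS) E0 \<Delta> y u)))"
  by (insert family[unfolded energy_family_def], (elim conjE, assumption)+)

lemma chart_of_atlas: "d \<in> AS \<Longrightarrow> is_chart d"
  using atlases by (simp add: smooth_atlas_def)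

lemma open_chart: "d \<in> AS \<Longrightarrow> open (fst d)" "d \<in> AS \<Longrightarrow> open (snd d ` fst d)"
  using chart_of_atlas by (auto simp: is_chart_def)

lemma ex_frame: "\<exists>C::'es set. parseval_frame C"
proof -
  have "\<exists>B::'es set. finite B \<and> span B = UNIV"
    using atlases(2) by (simp add: smooth_atlas_def)
  then show ?thesis using parseval_frame_exists by blast
qed

lemma
  assumes "u \<in> U"
  shows minimizer_mem: "\<sigma> u \<in> points AS"
    and minimizer_le: "s \<in> points AS \<Longrightarrow> E (\<sigma> u) u \<le> E s u"
    and minimizer_unique: "s \<in> points AS \<Longrightarrow> E s u \<le> E (\<sigma> u) u \<Longrightarrow> s = \<sigma> u"
proof -
  let ?P = "is_arg_min (\<lambda>s. E s u) (\<lambda>s. s \<in> points AS)"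
  have ex: "\<exists>!s. ?P s"
    using bspec[OF bspec[OF minimizers y] assms] by (rule conjunct1)
  have \<sigma>: "?P (\<sigma> u)"
    unfolding minimizer_def arg_min_on_def arg_min_def by (rule someI_ex) (use ex in blast)
  then show "\<sigma> u \<in> points AS" "s \<in> points AS \<Longrightarrow> E (\<sigma> u) u \<le> E s u"
    by (auto simp: is_arg_min_def not_less)
  then show "s = \<sigma> u" if "s \<in> points AS" "E s u \<le> E (\<sigma> u) u"
  proof -
    have "?P s" using \<sigma> that by (force simp: is_arg_min_def)
    then show ?thesis using ex \<sigma> by blast
  qed
qed

lemma Ck_on_energy:
  assumes "u \<in> U" "d \<in> AS"
  shows "Ck_on 3 ((\<lambda>s. E s u) \<circ> chart_inv d) (snd d ` fst d)"
proof -
  obtain c where c: "c \<in> AY" "y \<in> fst c" using y by (auto simp: points_def)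
  have yc: "chart_inv c (snd c y) = y"
    using atlases(1) c by (intro chart_inv_coord) (auto simp: smooth_atlas_def)
  let ?f = "\<lambda>(a, x, u). energy E0 \<Delta> (chart_inv c a) (chart_inv d x) u"
  have "Ck_on (r + 1) ?f ((snd c ` fst c) \<times> (snd d ` fst d) \<times> U)"
    by (rule bspec[OF bspec[OF smooth_energy c(1)] assms(2)])
  moreover have "3 \<le> r + 1" using regularity by simp
  ultimately have "Ck_on 3 ?f ((snd c ` fst c) \<times> (snd d ` fst d) \<times> U)" by (rule Ck_on_mono)
  moreover have "bounded_linear (\<lambda>x::'es. (0::'ey, x, 0::real^'p))"
    by (intro bounded_linear_Pair bounded_linear_zero bounded_linear_ident)
  ultimately have "Ck_on 3 (\<lambda>x. ?f ((snd c y, 0, u) + (0, x, 0))) (snd d ` fst d)"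
    using c(2) assms by (intro Ck_on_compose_affine open_chart) auto
  then show ?thesis by (simp add: yc comp_def)
qed

text \<open>The mechanisms are difference quotients of the energy in the parameter, and so they inherit its
  smoothness; this is where the openness of \<open>U\<close> enters.\<close>

lemma Ck_on_mechanism:
  assumes "u \<in> U" "d \<in> AS"
  shows "Ck_on 3 (\<Delta> i y \<circ> chart_inv d) (snd d ` fst d)"
proof -
  obtain e where e: "e > 0" "ball u e \<subseteq> U" using open_U assms(1) open_contains_ball by blast
  define v where "v = u + (e / 2) *\<^sub>R axis i 1"
  have "dist u v < e" using e by (simp add: v_def dist_norm)
  then have v: "v \<in> U" using e by auto
  have diff: "E s v = E s u + e / 2 * \<Delta> i y s" for s
  proof -
    have "(\<Sum>j\<in>UNIV. (v $ j - u $ j) * \<Delta> j y s) = (\<Sum>j\<in>UNIV. if j = i then e / 2 * \<Delta> i y s else 0)"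
      by (intro sum.cong) (auto simp: v_def axis_def)
    then show ?thesis using energy_shift[of E0 \<Delta> y s v u] by simp
  qed
  let ?V = "snd d ` fst d"
  have "Ck_on 3 (\<lambda>x. 2 / e * (((\<lambda>s. E s v) \<circ> chart_inv d) x + - 1 * ((\<lambda>s. E s u) \<circ> chart_inv d) x)) ?V"
    using assms(2) v assms(1)
    by (intro Ck_on_mult Ck_on_add Ck_on_const Ck_on_energy open_chart)
  moreover have "(\<lambda>x. 2 / e * (((\<lambda>s. E s v) \<circ> chart_inv d) x + - 1 * ((\<lambda>s. E s u) \<circ> chart_inv d) x))
      = \<Delta> i y \<circ> chart_inv d"
    using e(1) by (auto simp: diff)
  ultimately show ?thesis by simp
qed

lemma continuous_on_energy:
  assumes "u \<in> U"
  shows "continuous_on (points AS) (\<lambda>s. E s u)"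
  using Ck_on_mono[OF Ck_on_energy[OF assms], of _ 0] by (intro continuous_on_points chart_of_atlas) auto

lemma continuous_on_mechanism:
  assumes "u \<in> U"
  shows "continuous_on (points AS) (\<Delta> i y)"
  using Ck_on_mono[OF Ck_on_mechanism[OF assms], of _ 0] by (intro continuous_on_points chart_of_atlas) auto

text \<open>For parameters near \<open>u0\<close> all minimizers lie in one sublevel set, whose relative closure is
  compact. On the part of it outside a neighbourhood \<open>W\<close> of the minimizer at \<open>u0\<close> the energy at \<open>u0\<close> exceeds
  its minimum by some \<open>m > 0\<close>, and a small change of the parameter changes energy differences by
  less than \<open>m\<close> there.\<close>

lemma tendsto_minimizer:
  assumes u0: "u0 \<in> U"
  shows "(\<sigma> \<longlongrightarrow> \<sigma> u0) (nhds u0)"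
proof (rule topological_tendstoI)
  fix W assume W: "open W" "\<sigma> u0 \<in> W"
  let ?S = "points AS"
  obtain e where e: "e > 0" "cball u0 e \<subseteq> U" using open_U u0 open_contains_cball by blast
  have "continuous_on (cball u0 e) (\<lambda>u. E (\<sigma> u0) u)"
    unfolding energy_def by (intro continuous_intros)
  moreover have "cball u0 e \<noteq> {}" using e(1) by simp
  ultimately obtain M where M: "\<And>u. u \<in> cball u0 e \<Longrightarrow> E (\<sigma> u0) u \<le> M"
    using continuous_attains_sup[OF compact_cball] by blast
  define A where "A = {s \<in> ?S. \<exists>(y, u)\<in>{y} \<times> cball u0 e. energy E0 \<Delta> y s u \<le> M}"
  have "compact ({y} \<times> cball u0 e)" "{y} \<times> cball u0 e \<subseteq> points AY \<times> U"
    using y e(2) by (auto intro: compact_Times)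
  then have "relatively_compact_in ?S A"
    unfolding A_def by (intro mp[OF spec[OF spec[OF coercive]]] conjI)
  then have comp: "compact (?S \<inter> closure A)" by (simp add: relatively_compact_in_def)
  have inQ: "\<sigma> u \<in> ?S \<inter> closure A" if "u \<in> cball u0 e" for u
  proof -
    have u: "u \<in> U" using that e(2) by auto
    have "E (\<sigma> u) u \<le> M"
      using minimizer_le[OF u minimizer_mem[OF u0]] M[OF that] by linarith
    then have "\<sigma> u \<in> A" using minimizer_mem[OF u] that unfolding A_def by auto
    then show ?thesis using minimizer_mem[OF u] closure_subset by auto
  qed
  have near: "\<forall>\<^sub>F u in nhds u0. dist u u0 < d" if "d > 0" for d
    using that eventually_nhds_metric by blast
  define Q where "Q = (?S \<inter> closure A) - W"
  have Q: "compact Q" "Q \<subseteq> ?S" unfolding Q_def using comp W(1) by (auto intro: compact_diff)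
  show "\<forall>\<^sub>F u in nhds u0. \<sigma> u \<in> W"
  proof (cases "Q = {}")
    case True
    show ?thesis using near[OF e(1)]
    proof eventually_elim
      case (elim u)
      then have "\<sigma> u \<in> ?S \<inter> closure A" by (intro inQ) (simp add: dist_commute)
      then show ?case using True unfolding Q_def by blast
    qed
  next
    case False
    obtain s1 where s1: "s1 \<in> Q" "\<And>s. s \<in> Q \<Longrightarrow> E s1 u0 \<le> E s u0"
      using continuous_attains_inf[OF Q(1) False continuous_on_subset[OF continuous_on_energy[OF u0] Q(2)]]
      by blast
    define m where "m = E s1 u0 - E (\<sigma> u0) u0"
    have "m > 0"
    proof (rule ccontr)
      assume "\<not> m > 0"
      then have "s1 = \<sigma> u0" using s1(1) Q(2) by (intro minimizer_unique[OF u0]) (auto simp: m_def)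
      then show False using s1(1) W(2) by (simp add: Q_def)
    qed
    define \<psi> where "\<psi> = (\<lambda>s. \<Sum>i\<in>UNIV. \<bar>\<Delta> i y s - \<Delta> i y (\<sigma> u0)\<bar>)"
    have "continuous_on Q \<psi>" unfolding \<psi>_def
      by (intro continuous_intros continuous_on_subset[OF continuous_on_mechanism[OF u0] Q(2)])
    then obtain s2 where s2: "\<And>s. s \<in> Q \<Longrightarrow> \<psi> s \<le> \<psi> s2"
      using continuous_attains_sup[OF Q(1) False] by blast
    have \<psi>0: "\<psi> s2 \<ge> 0" unfolding \<psi>_def by (intro sum_nonneg) auto
    define d where "d = min e (m / (\<psi> s2 + 1))"
    have "d > 0" using e(1) \<open>m > 0\<close> \<psi>0 by (simp add: d_def)
    show ?thesis using near[OF \<open>d > 0\<close>]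
    proof eventually_elim
      case (elim u)
      then have u: "u \<in> cball u0 e" by (simp add: d_def dist_commute)
      then have uU: "u \<in> U" using e(2) by auto
      have "\<sigma> u \<notin> Q"
      proof
        assume \<sigma>: "\<sigma> u \<in> Q"
        have "\<bar>\<Sum>i\<in>UNIV. (u $ i - u0 $ i) * (\<Delta> i y (\<sigma> u) - \<Delta> i y (\<sigma> u0))\<bar> \<le> norm (u - u0) * \<psi> (\<sigma> u)"
          unfolding \<psi>_def sum_distrib_left
        proof (intro order_trans[OF sum_abs] sum_mono)
          fix i
          show "\<bar>(u $ i - u0 $ i) * (\<Delta> i y (\<sigma> u) - \<Delta> i y (\<sigma> u0))\<bar>
              \<le> norm (u - u0) * \<bar>\<Delta> i y (\<sigma> u) - \<Delta> i y (\<sigma> u0)\<bar>"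
            unfolding abs_mult using component_le_norm_cart[of "u - u0" i]
            by (intro mult_right_mono) auto
        qed
        also have "\<dots> \<le> norm (u - u0) * (\<psi> s2 + 1)"
          using s2[OF \<sigma>] by (intro mult_left_mono) auto
        also have "\<dots> < m" using elim \<psi>0 by (simp add: d_def dist_norm pos_less_divide_eq)
        finally have small: "\<bar>\<Sum>i\<in>UNIV. (u $ i - u0 $ i) * (\<Delta> i y (\<sigma> u) - \<Delta> i y (\<sigma> u0))\<bar> < m" .
        have "E (\<sigma> u) u - E (\<sigma> u0) u = E (\<sigma> u) u0 - E (\<sigma> u0) u0
            + (\<Sum>i\<in>UNIV. (u $ i - u0 $ i) * (\<Delta> i y (\<sigma> u) - \<Delta> i y (\<sigma> u0)))"
          using energy_shift[of E0 \<Delta> y "\<sigma> u" u u0] energy_shift[of E0 \<Delta> y "\<sigma> u0" u u0]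
          by (simp add: right_diff_distrib sum_subtractf)
        moreover have "E (\<sigma> u) u0 - E (\<sigma> u0) u0 \<ge> m" using s1(2)[OF \<sigma>] by (simp add: m_def)
        ultimately have "E (\<sigma> u) u > E (\<sigma> u0) u" using small by linarith
        then show False using minimizer_le[OF uU minimizer_mem[OF u0]] by linarith
      qed
      then show ?case using inQ[OF u] unfolding Q_def by blast
    qed
  qed
qed

lemma tendsto_mechanism:
  assumes "u0 \<in> U"
  shows "((\<lambda>u. \<Delta> i y (\<sigma> u)) \<longlongrightarrow> \<Delta> i y (\<sigma> u0)) (nhds u0)"
proof -
  have "isCont (\<Delta> i y) (\<sigma> u0)"
    using continuous_on_mechanism[OF assms] open_points[of AS] chart_of_atlas minimizer_mem[OF assms]
    by (simp add: continuous_on_eq_continuous_at)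
  then show ?thesis by (rule isCont_tendsto_compose[OF _ tendsto_minimizer[OF assms]])
qed

text \<open>The envelope formula. Affinity in the parameter reduces it to the continuity of the minimizer:
  comparing the minimizers at \<open>u\<close> and \<open>u0\<close> in both energies bounds
  the error of the linearization from both sides.\<close>

lemma has_derivative_reduced_energy:
  assumes u0: "u0 \<in> U"
  shows "(Ebar has_derivative (\<lambda>h. \<Sum>i\<in>UNIV. h $ i * \<Delta> i y (\<sigma> u0))) (at u0)"
  unfolding has_derivative_at_alt
proof (intro conjI allI impI)
  show "bounded_linear (\<lambda>h::real^'p. \<Sum>i\<in>UNIV. h $ i * \<Delta> i y (\<sigma> u0))"
    by (intro bounded_linear_sum bounded_linear_mult_const bounded_linear_vec_nth)
  fix e :: real assume "e > 0"
  have "((\<lambda>u. \<Sum>i\<in>UNIV. \<bar>\<Delta> i y (\<sigma> u) - \<Delta> i y (\<sigma> u0)\<bar>) \<longlongrightarrow>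
      (\<Sum>i\<in>UNIV. \<bar>\<Delta> i y (\<sigma> u0) - \<Delta> i y (\<sigma> u0)\<bar>)) (nhds u0)"
    by (intro tendsto_intros tendsto_mechanism[OF u0])
  then have "\<forall>\<^sub>F u in nhds u0. (\<Sum>i\<in>UNIV. \<bar>\<Delta> i y (\<sigma> u) - \<Delta> i y (\<sigma> u0)\<bar>) < e"
    using \<open>e > 0\<close> by (intro order_tendstoD) auto
  moreover have "\<forall>\<^sub>F u in nhds u0. u \<in> U" using open_U u0 by (rule eventually_nhds_in_open)
  ultimately have "\<forall>\<^sub>F u in nhds u0.
      norm (Ebar u - Ebar u0 - (\<Sum>i\<in>UNIV. (u - u0) $ i * \<Delta> i y (\<sigma> u0))) \<le> e * norm (u - u0)"
  proof eventually_elim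
    case (elim u)
    let ?R = "Ebar u - Ebar u0 - (\<Sum>i\<in>UNIV. (u - u0) $ i * \<Delta> i y (\<sigma> u0))"
    \<comment> \<open>Each of the two minimizers is a competitor at the other parameter.\<close>
    have "?R \<le> 0"
      using minimizer_le[OF elim(2) minimizer_mem[OF u0]] energy_shift[of E0 \<Delta> y "\<sigma> u0" u u0]
      by (simp add: reduced_energy_def)
    moreover have "?R \<ge> (\<Sum>i\<in>UNIV. (u - u0) $ i * (\<Delta> i y (\<sigma> u) - \<Delta> i y (\<sigma> u0)))"
      using minimizer_le[OF u0 minimizer_mem[OF elim(2)]] energy_shift[of E0 \<Delta> y "\<sigma> u" u u0]
      by (simp add: reduced_energy_def right_diff_distrib sum_subtractf)
    moreover have "\<bar>\<Sum>i\<in>UNIV. (u - u0) $ i * (\<Delta> i y (\<sigma> u) - \<Delta> i y (\<sigma> u0))\<bar>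
        \<le> (\<Sum>i\<in>UNIV. norm (u - u0) * \<bar>\<Delta> i y (\<sigma> u) - \<Delta> i y (\<sigma> u0)\<bar>)"
      by (intro order_trans[OF sum_abs] sum_mono)
         (auto simp: abs_mult simp del: vector_minus_component intro!: mult_right_mono component_le_norm_cart)
    moreover have "\<dots> \<le> norm (u - u0) * e"
      unfolding sum_distrib_left[symmetric] using elim(1) by (intro mult_left_mono) auto
    ultimately have "\<bar>?R\<bar> \<le> norm (u - u0) * e" by linarith
    then show ?case by (simp add: mult.commute)
  qed
  then show "\<exists>d>0. \<forall>u. norm (u - u0) < d \<longrightarrow>
      norm (Ebar u - Ebar u0 - (\<Sum>i\<in>UNIV. (u - u0) $ i * \<Delta> i y (\<sigma> u0))) \<le> e * norm (u - u0)"
    by (simp only: eventually_nhds_metric dist_norm)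
qed

section \<open>The Hessian of the reduced energy\<close>

abbreviation hess :: "('s, 'es) chart \<Rightarrow> real^'p \<Rightarrow> 'es \<Rightarrow>\<^sub>L ('es \<Rightarrow>\<^sub>L real)" where
  "hess d u \<equiv> chart_hessian d (\<lambda>s. E s u) (\<sigma> u)"

text \<open>The map \<open>G\<close> in the coordinates of the chart \<open>d\<close>.\<close>

abbreviation forcing :: "('s, 'es) chart \<Rightarrow> real^'p \<Rightarrow> real^'p \<Rightarrow> 'es \<Rightarrow>\<^sub>L real" where
  "forcing d u a \<equiv> \<Sum>i\<in>UNIV. a $ i *\<^sub>R chart_differential d (\<Delta> i y) (\<sigma> u)"

lemma pos_def_hess:
  assumes "u \<in> U" "d \<in> AS" "\<sigma> u \<in> fst d"
  shows "positive_definite (hess d u)"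
  using bspec[OF bspec[OF minimizers y] assms(1)] assms(2,3) by blast

lemma Ck_on_2_chart:
  assumes "u \<in> U" "d \<in> AS"
  shows "Ck_on 2 ((\<lambda>s. E s u) \<circ> chart_inv d) (snd d ` fst d)"
    and "Ck_on 2 (\<Delta> i y \<circ> chart_inv d) (snd d ` fst d)"
  using Ck_on_mono[OF Ck_on_energy[OF assms], of 2] Ck_on_mono[OF Ck_on_mechanism[OF assms], of 2] by auto

lemma eventually_minimizer_in_chart:
  assumes "u0 \<in> U" "d \<in> AS" "\<sigma> u0 \<in> fst d"
  shows "\<forall>\<^sub>F u in nhds u0. u \<in> U \<and> \<sigma> u \<in> fst d"
  using topological_tendstoD[OF tendsto_minimizer[OF assms(1)] open_chart(1)[OF assms(2)] assms(3)]
    eventually_nhds_in_open[OF open_U assms(1)] by (simp add: eventually_conj)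

lemma tendsto_chart_minimizer:
  assumes "u0 \<in> U" "d \<in> AS" "\<sigma> u0 \<in> fst d"
  shows "((\<lambda>u. snd d (\<sigma> u)) \<longlongrightarrow> snd d (\<sigma> u0)) (nhds u0)"
proof -
  have "isCont (snd d) (\<sigma> u0)"
    using continuous_on_chart[OF chart_of_atlas[OF assms(2)]] open_chart(1)[OF assms(2)] assms(3)
    by (simp add: continuous_on_eq_continuous_at)
  then show ?thesis by (rule isCont_tendsto_compose[OF _ tendsto_minimizer[OF assms(1)]])
qed

text \<open>The gradient of the reduced energy has the components \<open>\<Delta>\<^sub>j \<circ> \<sigma>\<close>, and the minimizer moves with
  velocity \<open>- H\<^sup>-\<^sup>1 G h\<close>; the chain rule combines the two.\<close>

lemma has_derivative_mechanism_at_minimizer: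
  assumes u0: "u0 \<in> U" and d: "d \<in> AS" "\<sigma> u0 \<in> fst d"
  shows "((\<lambda>u. \<Delta> j y (\<sigma> u)) has_derivative
    (\<lambda>h. - dual_form (hess d u0) (chart_differential d (\<Delta> j y) (\<sigma> u0)) (forcing d u0 h))) (at u0)"
proof -
  obtain C :: "'es set" where "parseval_frame C" using ex_frame by blast
  then interpret parseval_frame C .
  let ?V = "snd d ` fst d"
  let ?f = "(\<lambda>s. E s u0) \<circ> chart_inv d" and ?D = "\<lambda>i. \<Delta> i y \<circ> chart_inv d"
  let ?X = "\<lambda>u. snd d (\<sigma> u)"
  note V = open_chart(2)[OF d(1)]
  note inv = chart_inv_coord[OF chart_of_atlas[OF d(1)]]
  have X0: "?X u0 \<in> ?V" using d(2) by (rule imageI)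
  have contX: "isCont ?X u0"
    unfolding isCont_def
    by (rule iffD2[OF tendsto_at_iff_tendsto_nhds tendsto_chart_minimizer[OF u0 d]])
  have pos: "positive_definite (fderiv2 ?f (?X u0))"
    using pos_def_hess[OF u0 d] by (simp add: chart_hessian_def)
  note ev = eventually_minimizer_in_chart[OF u0 d]
  have min: "\<forall>\<^sub>F u in nhds u0. \<forall>x\<in>?V. ?f (?X u) + (\<Sum>i\<in>UNIV. (u $ i - u0 $ i) * ?D i (?X u))
      \<le> ?f x + (\<Sum>i\<in>UNIV. (u $ i - u0 $ i) * ?D i x)"
    using ev
  proof eventually_elim
    case (elim u)
    show ?case
    proof
      fix x assume "x \<in> ?V"
      then obtain s where s: "s \<in> fst d" "x = snd d s" by blast
      then have "s \<in> points AS" using d(1) by (auto simp: points_def)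
      then have "E (\<sigma> u) u \<le> E s u" using elim by (intro minimizer_le) auto
      then show "?f (?X u) + (\<Sum>i\<in>UNIV. (u $ i - u0 $ i) * ?D i (?X u))
          \<le> ?f x + (\<Sum>i\<in>UNIV. (u $ i - u0 $ i) * ?D i x)"
        using elim s by (simp add: inv energy_shift[of E0 \<Delta> y _ u u0])
    qed
  qed
  have dX: "(?X has_derivative (\<lambda>h. - form_inv (hess d u0) (forcing d u0 h))) (at u0)"
    unfolding chart_hessian_def chart_differential_def
    by (rule has_derivative_local_minimizer[OF V Ck_on_2_chart[OF u0 d(1)] contX X0 pos min])
  have "?D j differentiable (at (?X u0))"
    using Ck_on_2_chart(2)[OF u0 d(1), of j] d(2) by (simp add: numeral_2_eq_2)
  then have "(?D j has_derivative blinfun_apply (chart_differential d (\<Delta> j y) (\<sigma> u0))) (at (?X u0))"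
    unfolding chart_differential_def by (rule has_derivative_fderiv)
  from has_derivative_compose[OF dX this]
  have der: "((\<lambda>u. ?D j (?X u)) has_derivative (\<lambda>h. - dual_form (hess d u0)
      (chart_differential d (\<Delta> j y) (\<sigma> u0)) (forcing d u0 h))) (at u0)"
    by (simp add: dual_form_def blinfun.minus_right)
  obtain T where T: "open T" "u0 \<in> T" "\<And>u. u \<in> T \<Longrightarrow> \<sigma> u \<in> fst d"
    using ev unfolding eventually_nhds by blast
  show ?thesis
    by (rule has_derivative_transform_within_open[OF der T(1,2)]) (simp add: inv T(3))
qed

text \<open>Along the minimizers both the point and the energy vary with \<open>u\<close>. The second derivative in the chart is
  affine in the parameter, so the continuity of finitely many fixed second derivatives suffices.\<close>

lemma tendsto_hess:
  assumes u0: "u0 \<in> U" and d: "d \<in> AS" "\<sigma> u0 \<in> fst d"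
  shows "(hess d \<longlongrightarrow> hess d u0) (nhds u0)"
proof -
  obtain C :: "'es set" where "parseval_frame C" using ex_frame by blast
  then interpret parseval_frame C .
  let ?V = "snd d ` fst d"
  let ?f = "(\<lambda>s. E s u0) \<circ> chart_inv d" and ?D = "\<lambda>i. \<Delta> i y \<circ> chart_inv d"
  let ?X = "\<lambda>u. snd d (\<sigma> u)"
  note V = open_chart(2)[OF d(1)]
  note C2 = Ck_on_2_chart[OF u0 d(1)]
  have X0: "?X u0 \<in> ?V" using d(2) by (rule imageI)
  have cont: "((\<lambda>u. fderiv2 g (?X u)) \<longlongrightarrow> fderiv2 g (?X u0)) (nhds u0)"
    if "Ck_on 2 g ?V" for g :: "'es \<Rightarrow> real"
  proof -
    have "isCont (fderiv2 g) (?X u0)"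
      using continuous_on_eq_continuous_at[OF V, of "fderiv2 g"] continuous_on_fderiv2[OF V that] X0
      by blast
    then show ?thesis by (rule isCont_tendsto_compose[OF _ tendsto_chart_minimizer[OF u0 d]])
  qed
  have "((\<lambda>u. fderiv2 ?f (?X u) + (\<Sum>i\<in>UNIV. (u $ i - u0 $ i) *\<^sub>R fderiv2 (?D i) (?X u)))
      \<longlongrightarrow> fderiv2 ?f (?X u0) + (\<Sum>i\<in>UNIV. (u0 $ i - u0 $ i) *\<^sub>R fderiv2 (?D i) (?X u0))) (nhds u0)"
    by (intro tendsto_add tendsto_sum tendsto_scaleR tendsto_diff tendsto_vec_nth tendsto_const
        filterlim_ident cont C2)
  then have lim: "((\<lambda>u. fderiv2 ?f (?X u) + (\<Sum>i\<in>UNIV. (u $ i - u0 $ i) *\<^sub>R fderiv2 (?D i) (?X u)))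
      \<longlongrightarrow> hess d u0) (nhds u0)"
    by (simp add: chart_hessian_def)
  have "\<forall>\<^sub>F u in nhds u0. fderiv2 ?f (?X u) + (\<Sum>i\<in>UNIV. (u $ i - u0 $ i) *\<^sub>R fderiv2 (?D i) (?X u))
      = hess d u"
    using eventually_minimizer_in_chart[OF u0 d]
  proof eventually_elim
    case (elim u)
    have "(\<lambda>s. E s u) \<circ> chart_inv d = (\<lambda>x. ?f x + (\<Sum>i\<in>UNIV. (u $ i - u0 $ i) * ?D i x))"
      by (simp add: fun_eq_iff energy_shift[of E0 \<Delta> y _ u u0])
    then show ?case
      using fderiv2_affine_combination[OF V C2, of "?X u" "\<lambda>i. u $ i - u0 $ i"] elim
      by (simp add: chart_hessian_def)
  qed
  from Lim_transform_eventually[OF lim this] show ?thesis .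
qed

lemma tendsto_chart_differential:
  assumes u0: "u0 \<in> U" and d: "d \<in> AS" "\<sigma> u0 \<in> fst d"
  shows "((\<lambda>u. chart_differential d (\<Delta> i y) (\<sigma> u)) \<longlongrightarrow> chart_differential d (\<Delta> i y) (\<sigma> u0)) (nhds u0)"
proof -
  obtain C :: "'es set" where "parseval_frame C" using ex_frame by blast
  then interpret parseval_frame C .
  have "isCont (fderiv (\<Delta> i y \<circ> chart_inv d)) (snd d (\<sigma> u0))"
    using has_derivative_fderiv2[OF open_chart(2)[OF d(1)] Ck_on_2_chart(2)[OF u0 d(1)]] d(2)
    by (intro has_derivative_continuous) auto
  then show ?thesis unfolding chart_differential_def
    by (rule isCont_tendsto_compose[OF _ tendsto_chart_minimizer[OF u0 d]])
qed

text \<open>A single chart contains the minimizers at all parameters near a given one, so continuity of the derivative can be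
  read off from its formula in that chart.\<close>

lemma Ck_on_mechanism_at_minimizer: "Ck_on 1 (\<lambda>u. \<Delta> j y (\<sigma> u)) U"
proof -
  obtain C :: "'es set" where "parseval_frame C" using ex_frame by blast
  then interpret parseval_frame C .
  let ?g = "\<lambda>u. \<Delta> j y (\<sigma> u)"
  have chart: "\<exists>d\<in>AS. \<sigma> u \<in> fst d" if "u \<in> U" for u
    using minimizer_mem[OF that] by (auto simp: points_def)
  have "?g differentiable (at u)" if u: "u \<in> U" for u
    using chart[OF u] has_derivative_mechanism_at_minimizer[OF u] by (blast intro: differentiableI)
  moreover have "isCont (\<lambda>u. frechet_derivative ?g (at u) w) u0" if u0: "u0 \<in> U" for u0 w
  proof -
    obtain d where d: "d \<in> AS" "\<sigma> u0 \<in> fst d" using chart[OF u0] by blast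
    let ?r = "\<lambda>u. - dual_form (hess d u) (chart_differential d (\<Delta> j y) (\<sigma> u)) (forcing d u w)"
    note ev = eventually_minimizer_in_chart[OF u0 d]
    have "\<forall>\<^sub>F u in nhds u0. positive_definite (hess d u)"
      using ev by eventually_elim (intro pos_def_hess[OF _ d(1)], auto)
    then have lim: "(?r \<longlongrightarrow> ?r u0) (nhds u0)"
      unfolding dual_form_def
      by (intro tendsto_minus blinfun.tendsto tendsto_form_inv tendsto_hess tendsto_sum
          tendsto_scaleR tendsto_const tendsto_chart_differential pos_def_hess u0 d)
    have eq: "?r u = frechet_derivative ?g (at u) w" if "u \<in> U" "\<sigma> u \<in> fst d" for u
      using frechet_derivative_at[OF has_derivative_mechanism_at_minimizer[OF that(1) d(1) that(2)]]
      by (rule fun_cong)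
    have "\<forall>\<^sub>F u in nhds u0. ?r u = frechet_derivative ?g (at u) w"
      using ev by eventually_elim (intro eq, auto)
    from Lim_transform_eventually[OF lim this]
    show ?thesis unfolding eq[OF u0 d(2)] isCont_def
      by (rule iffD2[OF tendsto_at_iff_tendsto_nhds])
  qed
  ultimately show ?thesis by (auto intro!: continuous_at_imp_continuous_on)
qed

lemma Ck_on_reduced_energy: "Ck_on 2 Ebar U"
  unfolding numeral_2_eq_2
proof (rule Ck_on_SucI[OF open_U has_derivative_reduced_energy])
  show "Ck_on (Suc 0) (\<lambda>u. \<Sum>i\<in>UNIV. v $ i * \<Delta> i y (\<sigma> u)) U" for v
    using Ck_on_mechanism_at_minimizer
    by (intro Ck_on_sum Ck_on_mult Ck_on_const open_U) simp
qed

lemma fderiv2_reduced_energy: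
  assumes u: "u \<in> U" and d: "d \<in> AS" "\<sigma> u \<in> fst d"
  shows "blinfun_apply (blinfun_apply (fderiv2 Ebar u) a) b = - dual_form (hess d u) (forcing d u b) (forcing d u a)"
proof -
  interpret parseval_frame "Basis :: (real^'p) set"
    by unfold_locales (simp_all add: euclidean_representation)
  have der: "((\<lambda>u. \<Sum>i\<in>UNIV. b $ i * \<Delta> i y (\<sigma> u)) has_derivative
      (\<lambda>h. \<Sum>i\<in>UNIV. b $ i * - dual_form (hess d u) (chart_differential d (\<Delta> i y) (\<sigma> u)) (forcing d u h))) (at u)"
    by (intro has_derivative_sum has_derivative_mult_right has_derivative_mechanism_at_minimizer u d)
  have eq: "(\<Sum>i\<in>UNIV. b $ i * \<Delta> i y (\<sigma> v)) = frechet_derivative Ebar (at v) b" if "v \<in> U" for v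
    using frechet_derivative_at[OF has_derivative_reduced_energy[OF that]] by (rule fun_cong)
  have "((\<lambda>v. frechet_derivative Ebar (at v) b) has_derivative
      (\<lambda>h. \<Sum>i\<in>UNIV. b $ i * - dual_form (hess d u) (chart_differential d (\<Delta> i y) (\<sigma> u)) (forcing d u h))) (at u)"
    by (rule has_derivative_transform_within_open[OF der open_U u eq])
  note fun_cong[OF frechet_derivative_at[OF this], of a]
  then have "blinfun_apply (blinfun_apply (fderiv2 Ebar u) a) b
      = (\<Sum>i\<in>UNIV. b $ i * - dual_form (hess d u) (chart_differential d (\<Delta> i y) (\<sigma> u)) (forcing d u a))"
    using fderiv2_apply[OF open_U Ck_on_reduced_energy u, of a b] by (simp only:)
  then show ?thesis
    by (simp add: dual_form_def blinfun.sum_left blinfun.scaleR_left sum_negf)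
qed

lemma partial_partial_reduced_energy:
  assumes u: "u \<in> U" and d: "d \<in> AS" "\<sigma> u \<in> fst d"
  shows "partial i (partial j Ebar) u = - dual_form (hess d u)
    (chart_differential d (\<Delta> j y) (\<sigma> u)) (chart_differential d (\<Delta> i y) (\<sigma> u))"
proof -
  have axis: "(\<Sum>k\<in>UNIV. axis i 1 $ k *\<^sub>R f k) = f i" for f :: "'p \<Rightarrow> 'b::real_vector" and i
  proof -
    have "(\<Sum>k\<in>UNIV. axis i 1 $ k *\<^sub>R f k) = (\<Sum>k\<in>UNIV. if k = i then f i else 0)"
      by (intro sum.cong) (auto simp: axis_def)
    then show ?thesis by simp
  qed
  have "partial j Ebar v = \<Delta> j y (\<sigma> v)" if "v \<in> U" for v
    using partial_eq[OF has_derivative_reduced_energy[OF that], of j] axis[of j "\<lambda>k. \<Delta> k y (\<sigma> v)"]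
    by simp
  then have "(partial j Ebar has_derivative (\<lambda>h. - dual_form (hess d u)
      (chart_differential d (\<Delta> j y) (\<sigma> u)) (forcing d u h))) (at u)"
    by (intro has_derivative_transform_within_open[OF has_derivative_mechanism_at_minimizer[OF u d] open_U u])
       simp
  from partial_eq[OF this, of i] show ?thesis by (simp only: axis)
qed

lemma is_inner_product_dual_hess:
  assumes u: "u \<in> U" and d: "d \<in> AS" "\<sigma> u \<in> fst d"
  shows "bij (blinfun_apply (hess d u))" "is_inner_product (dual_form (hess d u))"
proof -
  obtain C :: "'es set" where "parseval_frame C" using ex_frame by blast
  then interpret parseval_frame C .
  show "bij (blinfun_apply (hess d u))" by (rule pos_def_form_bij[OF pos_def_hess[OF u d]])
  show "is_inner_product (dual_form (hess d u))"
  proof (rule is_inner_product_dual_form[OF pos_def_hess[OF u d]])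
    show "blinfun_apply (blinfun_apply (hess d u) v) w = blinfun_apply (blinfun_apply (hess d u) w) v" for v w
      unfolding chart_hessian_def
      by (rule fderiv2_symmetric[OF open_chart(2)[OF d(1)] Ck_on_2_chart(1)[OF u d(1)] imageI[OF d(2)]])
  qed
qed

end

lemma second_derivative_formula:
  fixes r :: nat
    and AY :: "('y::{t2_space,second_countable_topology}, 'ey::real_inner) atlas"
    and AS :: "('s::{t2_space,second_countable_topology}, 'es::real_inner) atlas"
    and U :: "(real^'p::finite) set"
    and E0 :: "'y \<Rightarrow> 's \<Rightarrow> real"
    and \<Delta> :: "'p \<Rightarrow> 'y \<Rightarrow> 's \<Rightarrow> real"
  assumes "energy_family r AY AS U E0 \<Delta>" "y \<in> points AY" and u: "u \<in> U"
    and d: "d \<in> AS" "minimizer (points AS) E0 \<Delta> y u \<in> fst d"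
  shows "let \<sigma> = minimizer (points AS) E0 \<Delta> y u;
             Ebar = reduced_energy (points AS) E0 \<Delta> y;
             H = chart_hessian d (\<lambda>\<sigma>. energy E0 \<Delta> y \<sigma> u) \<sigma>;
             D\<Delta> = (\<lambda>i. chart_differential d (\<Delta> i y) \<sigma>);
             G = (\<lambda>a::real^'p. \<Sum>i\<in>UNIV. a $ i *\<^sub>R D\<Delta> i)
         in bij (blinfun_apply H) \<and>
            is_inner_product (dual_form H) \<and>
            Ck_on 2 Ebar U \<and>
            (\<forall>a. blinfun_apply (fderiv2 Ebar u) a = - dual_map G (form_inv H (G a))) \<and>
            (\<forall>a. blinfun_apply (blinfun_apply (fderiv2 Ebar u) a) a \<le> 0) \<and>
            (\<forall>i j. partial i (partial j Ebar) u
                   = - blinfun_apply (D\<Delta> i) (form_inv H (D\<Delta> j))) \<and>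
            (\<forall>i. partial i (partial i Ebar) u \<le> 0) \<and>
            (\<forall>i j. i \<noteq> j \<longrightarrow>
               (partial i (partial j Ebar) u = 0 \<longleftrightarrow> dual_form H (D\<Delta> i) (D\<Delta> j) = 0))"
proof -
  interpret affine_energy r AY AS U E0 \<Delta> y
    by unfold_locales (fact assms)+
  note ip = is_inner_product_dual_hess[OF u d]
  let ?B = "dual_form (hess d u)"
  have sym: "?B \<alpha> \<beta> = ?B \<beta> \<alpha>" for \<alpha> \<beta>
    using ip(2) unfolding is_inner_product_def by blast
  have nonneg: "?B \<alpha> \<alpha> \<ge> 0" for \<alpha>
  proof (cases "\<alpha> = 0")
    case True
    then show ?thesis by (simp add: dual_form_def)
  next
    case False
    then show ?thesis using ip(2) unfolding is_inner_product_def by (simp add: less_imp_le)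
  qed
  have dual: "blinfun_apply (fderiv2 Ebar u) a = - dual_map (forcing d u) (form_inv (hess d u) (forcing d u a))" for a
  proof (rule blinfun_eqI)
    fix b
    have "bounded_linear (\<lambda>a. blinfun_apply (forcing d u a) v)" for v
      unfolding blinfun.sum_left blinfun.scaleR_left
      by (intro bounded_linear_sum bounded_linear_scaleR_const bounded_linear_vec_nth)
    then show "blinfun_apply (blinfun_apply (fderiv2 Ebar u) a) b
        = blinfun_apply (- dual_map (forcing d u) (form_inv (hess d u) (forcing d u a))) b"
      by (simp only: fderiv2_reduced_energy[OF u d] dual_map_def blinfun.minus_left
          bounded_linear_Blinfun_apply dual_form_def)
  qed
  have part: "partial i (partial j Ebar) u = - ?B (chart_differential d (\<Delta> i y) (\<sigma> u))
      (chart_differential d (\<Delta> j y) (\<sigma> u))" for i j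
    unfolding partial_partial_reduced_energy[OF u d] by (simp only: sym)
  show ?thesis
    unfolding Let_def
  proof (intro conjI allI impI)
    show "blinfun_apply (blinfun_apply (fderiv2 Ebar u) a) a \<le> 0" for a
      unfolding fderiv2_reduced_energy[OF u d] using nonneg by simp
  qed (simp_all add: ip Ck_on_reduced_energy dual part nonneg dual_form_def[symmetric])
qed

section \<open>Mixed entries of either sign\<close>

text \<open>On the real line, the mechanisms \<open>c s\<close> and \<open>s\<close> with background \<open>s\<^sup>2\<close> give the energy
  \<open>s\<^sup>2 + (c u\<^sub>1 + u\<^sub>2) s\<close>, whose minimum is \<open>- (c u\<^sub>1 + u\<^sub>2)\<^sup>2 / 4\<close>. The mixed derivative is
  \<open>- c / 2\<close>, and \<open>c = \<plusminus>1\<close> realizes both signs.\<close>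

definition line_atlas :: "(real, real) atlas" where
  "line_atlas = {(UNIV, id)}"

definition quadratic_mechanism :: "real \<Rightarrow> 2 \<Rightarrow> real \<Rightarrow> real \<Rightarrow> real" where
  "quadratic_mechanism c i y s = (if i = 1 then c * s else s)"

abbreviation quadratic_energy :: "real \<Rightarrow> real \<Rightarrow> real \<Rightarrow> real^2 \<Rightarrow> real" where
  "quadratic_energy c \<equiv> energy (\<lambda>y s. s\<^sup>2) (quadratic_mechanism c)"

lemma quadratic_energy_eq:
  "quadratic_energy c y s u = s\<^sup>2 + (c * u $ 1 + u $ 2) * s"
  by (simp add: energy_def quadratic_mechanism_def UNIV_2 algebra_simps)

lemma quadratic_energy_square:
  "quadratic_energy c y s u = (s + (c * u $ 1 + u $ 2) / 2)\<^sup>2 - (c * u $ 1 + u $ 2)\<^sup>2 / 4"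
  unfolding quadratic_energy_eq by (simp add: power2_eq_square field_simps)

lemma quadratic_arg_min_iff:
  "is_arg_min (\<lambda>s. quadratic_energy c y s u) (\<lambda>s. s \<in> UNIV) s \<longleftrightarrow> s = - (c * u $ 1 + u $ 2) / 2"
proof -
  let ?m = "- (c * u $ 1 + u $ 2) / 2"
  have m: "?m + (c * u $ 1 + u $ 2) / 2 = 0" by (simp add: field_simps)
  have "quadratic_energy c y ?m u < quadratic_energy c y s u" if "s \<noteq> ?m"
  proof -
    have "s + (c * u $ 1 + u $ 2) / 2 \<noteq> 0" using that by (simp add: field_simps)
    then have "(s + (c * u $ 1 + u $ 2) / 2)\<^sup>2 > 0" by simp
    then show ?thesis unfolding quadratic_energy_square m by simp
  qed
  moreover have "quadratic_energy c y ?m u \<le> quadratic_energy c y t u" for t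
    unfolding quadratic_energy_square m by simp
  ultimately show ?thesis unfolding is_arg_min_def by (metis UNIV_I not_less)
qed

lemma points_line_atlas: "points line_atlas = UNIV"
  by (simp add: points_def line_atlas_def)

lemma chart_inv_line: "chart_inv (UNIV, id :: real \<Rightarrow> real) = id"
  by (simp add: chart_inv_def inv_id)

lemma minimizer_quadratic:
  "minimizer UNIV (\<lambda>y s. s\<^sup>2) (quadratic_mechanism c) y u = - (c * u $ 1 + u $ 2) / 2"
  unfolding minimizer_def arg_min_on_def arg_min_def quadratic_arg_min_iff by (rule some_eq_trivial)

lemma smooth_line_atlas: "smooth_atlas line_atlas"
proof -
  have "is_chart (UNIV, id :: real \<Rightarrow> real)"
    by (auto simp: is_chart_def intro!: homeomorphism_ident[unfolded id_def[symmetric]] exI[of _ id])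
  moreover have "\<exists>B::real set. finite B \<and> span B = UNIV"
    by (rule exI[of _ Basis]) (simp only: finite_Basis span_Basis simp_thms)
  moreover have "Ck_on k (\<lambda>x::real. x) UNIV" for k
    by (rule Ck_on_bounded_linear) (simp_all add: bounded_linear_ident)
  ultimately show ?thesis by (simp add: smooth_atlas_def line_atlas_def chart_inv_line comp_def)
qed

lemma quadratic_energy_family:
  "energy_family 2 line_atlas line_atlas UNIV (\<lambda>y s. s\<^sup>2) (quadratic_mechanism c)"
proof -
  let ?E = "quadratic_energy c"
  have smooth: "Ck_on (2 + 1) (\<lambda>(a::real, x::real, u). ?E a x u) (UNIV \<times> UNIV \<times> UNIV)"
  proof -
    have x: "Ck_on 3 (\<lambda>z. fst (snd z)) (UNIV :: (real \<times> real \<times> (real^2)) set)"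
      by (intro Ck_on_bounded_linear open_UNIV bounded_linear_fst_comp bounded_linear_snd)
    have u: "Ck_on 3 (\<lambda>z. snd (snd z) $ i) (UNIV :: (real \<times> real \<times> (real^2)) set)" for i
      by (intro Ck_on_bounded_linear open_UNIV bounded_linear_compose[OF bounded_linear_vec_nth]
          bounded_linear_snd_comp bounded_linear_snd)
    have "Ck_on 3 (\<lambda>z. fst (snd z) * fst (snd z)
        + (c * (snd (snd z) $ 1) + snd (snd z) $ 2) * fst (snd z)) (UNIV :: (real \<times> real \<times> (real^2)) set)"
      by (intro Ck_on_add Ck_on_mult Ck_on_const open_UNIV x u)
    then show ?thesis unfolding quadratic_energy_eq case_prod_beta' by (simp add: power2_eq_square)
  qed
  have coercive: "relatively_compact_in UNIV {s. \<exists>(y, u)\<in>K. ?E y s u \<le> e}"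
    if K: "compact K" for K :: "(real \<times> (real^2)) set" and e
  proof -
    have "continuous_on K (\<lambda>z. (c * snd z $ 1 + snd z $ 2) / 2)" by (intro continuous_intros) auto
    then have "bounded ((\<lambda>z. (c * snd z $ 1 + snd z $ 2) / 2) ` K)"
      using K by (intro compact_imp_bounded compact_continuous_image)
    then obtain M where M: "\<And>z. z \<in> K \<Longrightarrow> \<bar>(c * snd z $ 1 + snd z $ 2) / 2\<bar> \<le> M"
      unfolding bounded_iff by auto
    have "\<bar>s\<bar> \<le> M + (1 + (e + M\<^sup>2))" if "z \<in> K" "?E (fst z) s (snd z) \<le> e" for s z
    proof -
      \<comment> \<open>After completing the square, \<open>s\<close> lies within a bounded distance of the minimizer \<open>- b\<close>.\<close>
      define b where "b = (c * snd z $ 1 + snd z $ 2) / 2"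
      have b: "\<bar>b\<bar> \<le> M" using M[OF that(1)] by (simp only: b_def)
      define q where "q = (s + b)\<^sup>2"
      have "(c * snd z $ 1 + snd z $ 2)\<^sup>2 / 4 = b\<^sup>2" by (simp add: b_def power_divide)
      then have "q \<le> e + b\<^sup>2"
        using that(2) unfolding quadratic_energy_square q_def b_def by simp
      moreover have "b\<^sup>2 \<le> M\<^sup>2" using b by (simp add: abs_le_square_iff[symmetric])
      moreover have "2 * \<bar>s + b\<bar> \<le> 1 + q"
        using zero_le_power2[of "\<bar>s + b\<bar> - 1"] unfolding q_def power2_diff by simp
      ultimately have "2 * \<bar>s + b\<bar> \<le> 1 + (e + M\<^sup>2)" by simp
      moreover have "\<bar>s + b\<bar> \<le> 2 * \<bar>s + b\<bar>" by simp
      ultimately have "\<bar>s + b\<bar> \<le> 1 + (e + M\<^sup>2)" by (rule order_trans[rotated])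
      then show ?thesis using abs_triangle_ineq4[of "s + b" b] b by simp
    qed
    then have "bounded {s. \<exists>(y, u)\<in>K. ?E y s u \<le> e}"
      unfolding bounded_iff by (intro exI[of _ "M + (1 + (e + M\<^sup>2))"]) fastforce
    then show ?thesis by (simp add: relatively_compact_in_def compact_closure)
  qed
  have pos: "positive_definite (chart_hessian (UNIV, id) (\<lambda>s. ?E y s u) t)" for y u t
  proof -
    let ?k = "c * u $ 1 + u $ 2"
    let ?f = "\<lambda>s. ?E y s u"
    have 1: "fderiv ?f = (\<lambda>s. (2 * s + ?k) *\<^sub>R id_blinfun)"
    proof (rule ext, rule fderiv_eq)
      fix s
      show "(?f has_derivative blinfun_apply ((2 * s + ?k) *\<^sub>R id_blinfun)) (at s)"
        unfolding quadratic_energy_eq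
        by (auto intro!: derivative_eq_intros simp: fun_eq_iff blinfun.scaleR_left blinfun.add_left algebra_simps)
    qed
    have "fderiv (\<lambda>s. (2 * s + ?k) *\<^sub>R (id_blinfun :: real \<Rightarrow>\<^sub>L real)) t
        = 2 *\<^sub>R blinfun_scaleR_left id_blinfun"
      by (rule fderiv_eq)
         (auto intro!: derivative_eq_intros simp: fun_eq_iff blinfun.scaleR_left)
    then have "chart_hessian (UNIV, id) ?f t = 2 *\<^sub>R blinfun_scaleR_left id_blinfun"
      unfolding chart_hessian_def fderiv2_def chart_inv_line by (simp add: comp_def 1)
    then show ?thesis
      by (simp add: positive_definite_def blinfun.scaleR_left zero_less_mult_iff linorder_neq_iff disj_commute)
  qed
  have ex1: "\<exists>!s. is_arg_min (\<lambda>s. ?E y s u) (\<lambda>s. s \<in> UNIV) s" for y u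
    unfolding quadratic_arg_min_iff by (rule ex1_eq(1))
  show ?thesis
    unfolding energy_family_def points_line_atlas
    using smooth coercive pos ex1 smooth_line_atlas
    by (simp add: line_atlas_def chart_inv_line)
qed

lemma mixed_partial_quadratic:
  "partial 1 (partial 2 (reduced_energy UNIV (\<lambda>y s. s\<^sup>2) (quadratic_mechanism c) y)) u = - c / 2"
proof -
  have reduced: "reduced_energy UNIV (\<lambda>y s. s\<^sup>2) (quadratic_mechanism c) y
      = (\<lambda>u. - (c * u $ 1 + u $ 2)\<^sup>2 / 4)"
  proof (rule ext)
    fix u :: "real^2"
    have "- (c * u $ 1 + u $ 2) / 2 + (c * u $ 1 + u $ 2) / 2 = 0" by (simp add: field_simps)
    then show "reduced_energy UNIV (\<lambda>y s. s\<^sup>2) (quadratic_mechanism c) y u = - (c * u $ 1 + u $ 2)\<^sup>2 / 4"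
      unfolding reduced_energy_def quadratic_energy_square minimizer_quadratic by (simp only: power_zero_numeral)
  qed
  note nth = bounded_linear.has_derivative[OF bounded_linear_vec_nth has_derivative_ident]
  have "((\<lambda>u::real^2. - (c * u $ 1 + u $ 2)\<^sup>2 / 4) has_derivative
      (\<lambda>h. - (c * u $ 1 + u $ 2) * (c * h $ 1 + h $ 2) / 2)) (at u)" for u
    by (auto intro!: derivative_eq_intros nth simp: fun_eq_iff algebra_simps)
  note partial_eq[OF this, of 2]
  then have p2: "partial 2 (reduced_energy UNIV (\<lambda>y s. s\<^sup>2) (quadratic_mechanism c) y)
      = (\<lambda>u. - (c * u $ 1 + u $ 2) / 2)"
    unfolding reduced by (auto simp: axis_def)
  have "((\<lambda>u::real^2. - (c * u $ 1 + u $ 2) / 2) has_derivative (\<lambda>h. - (c * h $ 1 + h $ 2) / 2)) (at u)"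
    by (auto intro!: derivative_eq_intros nth)
  from partial_eq[OF this, of 1] show ?thesis unfolding p2 by (simp add: axis_def)
qed

theorem theorem4:
  fixes r :: nat
    and AY :: "('y::{t2_space,second_countable_topology}, 'ey::real_inner) atlas"
    and AS :: "('s::{t2_space,second_countable_topology}, 'es::real_inner) atlas"
    and U :: "(real^'p::finite) set"
    and E0 :: "'y \<Rightarrow> 's \<Rightarrow> real"
    and \<Delta> :: "'p \<Rightarrow> 'y \<Rightarrow> 's \<Rightarrow> real"
  shows
    "(energy_family r AY AS U E0 \<Delta> \<longrightarrow>
      (\<forall>y\<in>points AY. \<forall>u\<in>U. \<forall>d\<in>AS. minimizer (points AS) E0 \<Delta> y u \<in> fst d \<longrightarrow>
        (let \<sigma> = minimizer (points AS) E0 \<Delta> y u;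
             Ebar = reduced_energy (points AS) E0 \<Delta> y;
             H = chart_hessian d (\<lambda>\<sigma>. energy E0 \<Delta> y \<sigma> u) \<sigma>;
             D\<Delta> = (\<lambda>i. chart_differential d (\<Delta> i y) \<sigma>);
             G = (\<lambda>a::real^'p. \<Sum>i\<in>UNIV. a $ i *\<^sub>R D\<Delta> i)
         in bij (blinfun_apply H) \<and>
            is_inner_product (dual_form H) \<and>
            Ck_on 2 Ebar U \<and>
            (\<forall>a. blinfun_apply (fderiv2 Ebar u) a = - dual_map G (form_inv H (G a))) \<and>
            (\<forall>a. blinfun_apply (blinfun_apply (fderiv2 Ebar u) a) a \<le> 0) \<and>
            (\<forall>i j. partial i (partial j Ebar) u
                   = - blinfun_apply (D\<Delta> i) (form_inv H (D\<Delta> j))) \<and>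
            (\<forall>i. partial i (partial i Ebar) u \<le> 0) \<and>
            (\<forall>i j. i \<noteq> j \<longrightarrow>
               (partial i (partial j Ebar) u = 0 \<longleftrightarrow> dual_form H (D\<Delta> i) (D\<Delta> j) = 0)))))
     \<and> (\<exists>(r::nat) (AY::(real, real) atlas) (AS::(real, real) atlas) (U::(real^2) set) E0 \<Delta>.
          energy_family r AY AS U E0 \<Delta> \<and>
          (\<exists>y\<in>points AY. \<exists>u\<in>U. \<exists>i j. i \<noteq> j \<and>
             partial i (partial j (reduced_energy (points AS) E0 \<Delta> y)) u > 0))
     \<and> (\<exists>(r::nat) (AY::(real, real) atlas) (AS::(real, real) atlas) (U::(real^2) set) E0 \<Delta>.
          energy_family r AY AS U E0 \<Delta> \<and>
          (\<exists>y\<in>points AY. \<exists>u\<in>U. \<exists>i j. i \<noteq> j \<and>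
             partial i (partial j (reduced_energy (points AS) E0 \<Delta> y)) u < 0))"
  (is "?general \<and> ?pos \<and> ?neg")
proof (intro conjI)
  show ?general
    by (intro impI ballI second_derivative_formula)
next
  have "0 < partial 1 (partial 2 (reduced_energy (points line_atlas) (\<lambda>y s. s\<^sup>2)
      (quadratic_mechanism (- 1)) 0)) 0"
    by (simp add: points_line_atlas mixed_partial_quadratic)
  then show ?pos
    using quadratic_energy_family[of "- 1"]
    by (intro exI[of _ 2] exI[of _ line_atlas] exI[of _ UNIV] exI[of _ "\<lambda>y s. s\<^sup>2"]
        exI[of _ "quadratic_mechanism (- 1)"] conjI bexI[of _ 0] exI[of _ 1])
      (simp_all add: points_line_atlas)
next
  have "partial 1 (partial 2 (reduced_energy (points line_atlas) (\<lambda>y s. s\<^sup>2)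
      (quadratic_mechanism 1) 0)) 0 < 0"
    by (simp add: points_line_atlas mixed_partial_quadratic)
  then show ?neg
    using quadratic_energy_family[of 1]
    by (intro exI[of _ 2] exI[of _ line_atlas] exI[of _ UNIV] exI[of _ "\<lambda>y s. s\<^sup>2"]
        exI[of _ "quadratic_mechanism 1"] conjI bexI[of _ 0] exI[of _ 1])
      (simp_all add: points_line_atlas)
qed

end
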